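(* Any nonlocal product Hamiltonian $H$ can reversibly simulate any other nonlocal product Hamiltonian $H'$ (possibly acting on systems of different dimensions), with optimal simulation rate $$\gamma_{H'|H}=\frac{K_\otimes(H)}{K_\otimes(H')},$$ so that in particular $\gamma_{H'|H}\gamma_{H|H'}=1$.
   Context: All Hamiltonians are Hermitian operators on finite-dimensional Hilbert spaces. A bipartite Hamiltonian acts on $\mathcal H_A\otimes\mathcal H_B$, with system $A$ held by Alice and $B$ by Bob; it is local if it has the form $H_A\otimes I_B+I_A\otimes H_B$ and nonlocal otherwise. Simulation model: given a bipartite Hamiltonian $H$, Alice and Bob may attach or discard local ancillary systems of arbitrary finite dimension (on which $H$ acts trivially), apply arbitrary instantaneous local unitaries $U_A\otimes U_B$ (each acting on that party's system together with their ancillas), and switch $H$ on for chosen time intervals; the goal is to track (stroboscopically, for arbitrarily finely spaced times) the evolution $e^{-iH't}$ of a target bipartite Hamiltonian $H'$. The simulation rate $\gamma_{H'|H}$ is the supremum of $\gamma\ge 0$ such that evolution under $H'$ for any time $t$ can be achieved in this way (in the limit of arbitrarily fine time slicing) using $H$ for total time $t/\gamma$. $H$ and $H'$ simulate each other reversibly if $\gamma_{H|H'}\gamma_{H'|H}=1$. A product Hamiltonian is $H=H_A\otimes H_B$ with $H_A$, $H_B$ Hermitian on $\mathcal H_A$, $\mathcal H_B$; $\Delta_A$ (resp. $\Delta_B$) denotes the difference between the largest and smallest eigenvalues of $H_A$ (resp. $H_B$), and $K_\otimes(H)=\tfrac14\Delta_A\Delta_B$. *)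

theory Defs
  imports "Jordan_Normal_Form.Char_Poly"
begin

text \<open>A bipartite system with local dimensions dA, dB is modelled on C^(dA*dB),
  the basis vector |i>|j> having index i*dB + j.\<close>

definition adj :: "complex mat \<Rightarrow> complex mat" where
  "adj M = mat (dim_col M) (dim_row M) (\<lambda>(i,j). cnj (M $$ (j,i)))"

definition hermitian :: "nat \<Rightarrow> complex mat \<Rightarrow> bool" where
  "hermitian n M \<longleftrightarrow> M \<in> carrier_mat n n \<and> adj M = M"

definition unitary :: "nat \<Rightarrow> complex mat \<Rightarrow> bool" where
  "unitary n U \<longleftrightarrow> U \<in> carrier_mat n n \<and> adj U * U = 1\<^sub>m n"

definition kron :: "complex mat \<Rightarrow> complex mat \<Rightarrow> complex mat" where
  "kron A B = mat (dim_row A * dim_row B) (dim_col A * dim_col B)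
     (\<lambda>(i,j). A $$ (i div dim_row B, j div dim_col B) * B $$ (i mod dim_row B, j mod dim_col B))"

definition mexp :: "complex mat \<Rightarrow> complex mat" where
  "mexp M = mat (dim_row M) (dim_col M) (\<lambda>(i,j). (\<Sum>k. ((M ^\<^sub>m k) $$ (i,j)) / of_nat (fact k)))"

definition vnorm :: "complex vec \<Rightarrow> real" where
  "vnorm v = sqrt (\<Sum>i<dim_vec v. (cmod (v $ i))\<^sup>2)"

definition bipartite_ham :: "nat \<Rightarrow> nat \<Rightarrow> complex mat \<Rightarrow> bool" where
  "bipartite_ham dA dB H \<longleftrightarrow> 0 < dA \<and> 0 < dB \<and> hermitian (dA * dB) H"

definition local_ham :: "nat \<Rightarrow> nat \<Rightarrow> complex mat \<Rightarrow> bool" where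
  "local_ham dA dB H \<longleftrightarrow> (\<exists>HA HB. hermitian dA HA \<and> hermitian dB HB \<and>
      H = kron HA (1\<^sub>m dB) + kron (1\<^sub>m dA) HB)"

definition nonlocal_ham :: "nat \<Rightarrow> nat \<Rightarrow> complex mat \<Rightarrow> bool" where
  "nonlocal_ham dA dB H \<longleftrightarrow> bipartite_ham dA dB H \<and> \<not> local_ham dA dB H"

definition spread :: "complex mat \<Rightarrow> real" where
  "spread M = Max (Re ` Collect (eigenvalue M)) - Min (Re ` Collect (eigenvalue M))"

definition K_prod :: "complex mat \<Rightarrow> complex mat \<Rightarrow> real" where
  "K_prod HA HB = spread HA * spread HB / 4"

text \<open>Alice's laboratory is C^nA, Bob's is C^nB, the whole lab is C^(nA*nB)
  (index iA*nB+iB). The resource Hamiltonian H on C^dA \<otimes> C^dB acts on the lab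
  via the identification C^nA = C^dA \<otimes> C^ra (nA = dA*ra), C^nB = C^dB \<otimes> C^rb
  (nB = dB*rb), trivially on the ancillary factors C^ra, C^rb.\<close>
definition lift_ham :: "nat \<Rightarrow> nat \<Rightarrow> complex mat \<Rightarrow> nat \<Rightarrow> nat \<Rightarrow> complex mat" where
  "lift_ham dA dB H ra rb = mat (dA*ra*(dB*rb)) (dA*ra*(dB*rb)) (\<lambda>(i,j).
     (let iA = i div (dB*rb); iB = i mod (dB*rb); jA = j div (dB*rb); jB = j mod (dB*rb) in
      if iA mod ra = jA mod ra \<and> iB mod rb = jB mod rb
      then H $$ ((iA div ra) * dB + iB div rb, (jA div ra) * dB + jB div rb) else 0))"

text \<open>A protocol: a list of steps (UA, UB, t): apply the local unitary UA \<otimes> UB, then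
  let H act for time t; finally apply a last local unitary. Operator applied first is
  the head of the list.\<close>
fun run_steps :: "nat \<Rightarrow> complex mat \<Rightarrow> (complex mat \<times> complex mat \<times> real) list \<Rightarrow> complex mat" where
  "run_steps N HL [] = 1\<^sub>m N"
| "run_steps N HL ((UA, UB, t) # xs) =
     run_steps N HL xs * (mexp ((- \<i> * complex_of_real t) \<cdot>\<^sub>m HL) * kron UA UB)"

text \<open>Input embedding: target system C^dA' \<otimes> C^dB' with Alice's lab
  C^nA = C^dA' \<otimes> C^a and Bob's lab C^nB = C^dB' \<otimes> C^b; ancillas in states
  alpha (Alice) and beta (Bob).\<close>
definition embed_in :: "nat \<Rightarrow> nat \<Rightarrow> nat \<Rightarrow> nat \<Rightarrow> complex vec \<Rightarrow> complex vec \<Rightarrow> complex vec \<Rightarrow> complex vec" where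
  "embed_in dA dB a b psi alpha beta = vec (dA*a*(dB*b)) (\<lambda>i.
     (let iA = i div (dB*b); iB = i mod (dB*b) in
       psi $ ((iA div a) * dB + iB div b) * alpha $ (iA mod a) * beta $ (iB mod b)))"

text \<open>Output: target state chi, and the (discarded) ancillas in an arbitrary joint state phi
  on C^a \<otimes> C^b (index xa*b+xb).\<close>
definition embed_out :: "nat \<Rightarrow> nat \<Rightarrow> nat \<Rightarrow> nat \<Rightarrow> complex vec \<Rightarrow> complex vec \<Rightarrow> complex vec" where
  "embed_out dA dB a b chi phi = vec (dA*a*(dB*b)) (\<lambda>i.
     (let iA = i div (dB*b); iB = i mod (dB*b) in
       chi $ ((iA div a) * dB + iB div b) * phi $ ((iA mod a) * b + iB mod b)))"

definition implementable ::
  "nat \<Rightarrow> nat \<Rightarrow> complex mat \<Rightarrow> real \<Rightarrow> nat \<Rightarrow> nat \<Rightarrow> complex mat \<Rightarrow> real \<Rightarrow> bool" where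
  "implementable dA dB H T dA' dB' U eps \<longleftrightarrow>
    (\<exists>nA nB ra rb a b alpha beta phi steps UAf UBf.
       nA = dA * ra \<and> nB = dB * rb \<and> nA = dA' * a \<and> nB = dB' * b \<and>
       alpha \<in> carrier_vec a \<and> vnorm alpha = 1 \<and>
       beta \<in> carrier_vec b \<and> vnorm beta = 1 \<and>
       phi \<in> carrier_vec (a*b) \<and> vnorm phi = 1 \<and>
       (\<forall>(UA, UB, t) \<in> set steps. unitary nA UA \<and> unitary nB UB \<and> 0 \<le> t) \<and>
       (\<Sum>(UA, UB, t) \<leftarrow> steps. t) \<le> T \<and>
       unitary nA UAf \<and> unitary nB UBf \<and>
       (\<forall>psi \<in> carrier_vec (dA' * dB').
          vnorm (kron UAf UBf * run_steps (nA*nB) (lift_ham dA dB H ra rb) steps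
                   *\<^sub>v embed_in dA' dB' a b psi alpha beta
                 - embed_out dA' dB' a b (U *\<^sub>v psi) phi) \<le> eps * vnorm psi))"

definition simulates_at_rate ::
  "nat \<Rightarrow> nat \<Rightarrow> complex mat \<Rightarrow> nat \<Rightarrow> nat \<Rightarrow> complex mat \<Rightarrow> real \<Rightarrow> bool" where
  "simulates_at_rate dA' dB' H' dA dB H \<gamma> \<longleftrightarrow>
    (\<forall>t \<ge> 0. \<forall>\<epsilon> > 0. implementable dA dB H (t / \<gamma>) dA' dB'
        (mexp ((- \<i> * complex_of_real t) \<cdot>\<^sub>m H')) \<epsilon>)"

definition sim_rate :: "nat \<Rightarrow> nat \<Rightarrow> complex mat \<Rightarrow> nat \<Rightarrow> nat \<Rightarrow> complex mat \<Rightarrow> real" where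
  "sim_rate dA' dB' H' dA dB H =
     Sup ({0} \<union> {\<gamma>. \<gamma> > 0 \<and> simulates_at_rate dA' dB' H' dA dB H \<gamma>})"

end

(*
Choose diagonalising bases and centre the spectra of HA and HB; the centring terms are local, so
exp(-itH) is within K t of a local unitary, where K = K_prod HA HB. A protocol using H for time T
therefore maps a product vector to within K T of a product vector, whatever the ancillas. On the
other hand, exp(-itH') maps the equal superposition of the extremal eigenvectors on both sides to a
vector with Schmidt coefficients cos(K' t) and sin(K' t), so its distance from product vectors is at
least 2 sin(K' t / 2). Letting t tend to 0 gives the bound K / K' on the rate.

This rate is attained without error. Attach ancillas and map the i-th eigenvector of HA' to one of
the two extremal eigenspaces of HA according to a sign s(i), and similarly for HB' with signs r(j).
Up to local phases, H for time tau then produces the phase -tau K s(i) r(j). The centred and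
normalised spectra of HA' and HB' are convex combinations of such sign functions, and all these
diagonal evolutions commute, so evolutions with times proportional to the weights compose to
exp(-itH') in total time t K' / K.
*)

theory Submission
  imports Defs "Jordan_Normal_Form.Schur_Decomposition" "Jordan_Normal_Form.Spectral_Radius"
    "HOL-Analysis.L2_Norm" "HOL-Combinatorics.Transposition"
begin

section \<open>Diagonal, unitary and Kronecker product matrices\<close>

text \<open>The two bounds meet because \<open>K_prod\<close> has two meanings. With half-spreads a
  and b, the number a * b is the operator norm of the centred product, which limits how fast a
  protocol can leave the local unitaries. It is also the strength of the Z \<otimes> Z coupling felt
  by the extremal eigenvectors, which drives both the test state of the target and the code states
  of the resource. The upper bound compares a chord with an elapsed time, so it is sharp only to
  first order in t; it also requires cos(K' t) to be the larger Schmidt coefficient, whence the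
  restriction K' t \<le> pi / 4. Nonlocality enters through the spreads: a zero spread makes one
  factor scalar and the product local, so nonlocal products have K, K' > 0. Every Hamiltonian is
  kept in the form U diag(x) adj U. Exponentials, ancilla lifts and tensor products then become
  statements about phases attached to indices, and the bookkeeping is division with
  remainder.\<close>

lemma index_less_mult: "(i::nat) < n \<Longrightarrow> j < m \<Longrightarrow> i * m + j < n * m"
  by (metis add.commute add_less_cancel_left le_less_trans less_le_trans mult_Suc mult_le_mono1 Suc_leI nat_add_left_cancel_less order_refl)

lemma sum_mult_split:
  fixes f :: "nat \<Rightarrow> 'a::comm_monoid_add"
  shows "(\<Sum>k<n * m. f k) = (\<Sum>i<n. \<Sum>j<m. f (i * m + j))"
proof -
  have "(\<Sum>k<n * m. f k) = (\<Sum>i<n. sum f {i * m..<i * m + m})"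
    by (simp add: sum.nat_group)
  also have "\<dots> = (\<Sum>i<n. \<Sum>j<m. f (i * m + j))"
  proof (rule sum.cong[OF refl])
    fix i
    show "sum f {i * m..<i * m + m} = (\<Sum>j<m. f (i * m + j))"
      using sum.shift_bounds_nat_ivl[of f 0 "i * m" m] by (simp add: add.commute lessThan_atLeast0)
  qed
  finally show ?thesis .
qed

lemma div_less_of_mult: "(i::nat) < n * m \<Longrightarrow> i div m < n"
  by (simp add: less_mult_imp_div_less)

lemma mod_less_of_mult: "(i::nat) < n * m \<Longrightarrow> i mod m < m"
  by (metis mod_less_divisor mult_0_right not_gr_zero not_less_zero)

lemma mult_mat_index:
  "A \<in> carrier_mat n m \<Longrightarrow> B \<in> carrier_mat m k \<Longrightarrow> i < n \<Longrightarrow> j < k \<Longrightarrow>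
    (A * B) $$ (i, j) = (\<Sum>l<m. A $$ (i, l) * B $$ (l, j))"
  by (auto simp: scalar_prod_def lessThan_atLeast0)

lemma mult_mat_vec_index:
  "A \<in> carrier_mat n m \<Longrightarrow> v \<in> carrier_vec m \<Longrightarrow> i < n \<Longrightarrow>
    (A *\<^sub>v v) $ i = (\<Sum>l<m. A $$ (i, l) * v $ l)"
  by (auto simp: scalar_prod_def lessThan_atLeast0)

lemma mult_square_carrier [simp]:
  "A \<in> carrier_mat n n \<Longrightarrow> B \<in> carrier_mat n n \<Longrightarrow> A * B \<in> carrier_mat n n"
  by (rule mult_carrier_mat)

lemma adj_dim [simp]: "dim_row (adj A) = dim_col A" "dim_col (adj A) = dim_row A"
  by (auto simp: adj_def)

lemma adj_carrier [simp]: "A \<in> carrier_mat n m \<Longrightarrow> adj A \<in> carrier_mat m n"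
  by (auto simp: adj_def)

lemma adj_index: "A \<in> carrier_mat n m \<Longrightarrow> i < m \<Longrightarrow> j < n \<Longrightarrow> adj A $$ (i, j) = cnj (A $$ (j, i))"
  by (auto simp: adj_def)

lemma adj_adj [simp]: "adj (adj A) = A"
  by (rule eq_matI) (auto simp: adj_def)

lemma adj_one [simp]: "adj (1\<^sub>m n) = 1\<^sub>m n"
  by (rule eq_matI) (auto simp: adj_def)

lemma adj_mult:
  assumes "A \<in> carrier_mat n m" "B \<in> carrier_mat m k"
  shows "adj (A * B) = adj B * adj A"
proof (rule eq_matI)
  fix i j assume "i < dim_row (adj B * adj A)" "j < dim_col (adj B * adj A)"
  then have ij: "i < k" "j < n" using assms by (auto simp: adj_def)
  have "adj (A * B) $$ (i, j) = cnj (\<Sum>l<m. A $$ (j, l) * B $$ (l, i))"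
    using ij assms mult_mat_index[OF assms, of j i] adj_index[of "A * B" n k i j] by auto
  also have "\<dots> = (\<Sum>l<m. adj B $$ (i, l) * adj A $$ (l, j))"
    unfolding cnj_sum
    by (rule sum.cong[OF refl]) (use ij assms in \<open>auto simp: adj_index[OF assms(1)] adj_index[OF assms(2)]\<close>)
  also have "\<dots> = (adj B * adj A) $$ (i, j)"
    using ij assms by (subst mult_mat_index[of _ k m _ n]) auto
  finally show "adj (A * B) $$ (i, j) = (adj B * adj A) $$ (i, j)" .
qed (use assms in \<open>auto simp: adj_def\<close>)

lemma unitaryD:
  assumes "unitary n U"
  shows "U \<in> carrier_mat n n" "adj U \<in> carrier_mat n n" "adj U * U = 1\<^sub>m n" "U * adj U = 1\<^sub>m n"
proof -
  show U: "U \<in> carrier_mat n n" and 1: "adj U * U = 1\<^sub>m n" using assms by (auto simp: unitary_def)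
  then show "adj U \<in> carrier_mat n n" by simp
  from mat_mult_left_right_inverse[OF this U 1] show "U * adj U = 1\<^sub>m n" .
qed

lemma unitary_adj: "unitary n U \<Longrightarrow> unitary n (adj U)"
  by (simp add: unitary_def[of n "adj U"] unitaryD)

lemma unitary_one [simp]: "unitary n (1\<^sub>m n)"
  by (simp add: unitary_def)

lemma unitary_mult:
  assumes "unitary n U" "unitary n V"
  shows "unitary n (U * V)"
proof -
  note U = unitaryD[OF assms(1)] and V = unitaryD[OF assms(2)]
  have "adj (U * V) * (U * V) = adj V * (adj U * (U * V))"
    using U V by (simp add: adj_mult[of _ n n _ n] assoc_mult_mat[of _ n n _ n _ n])
  also have "adj U * (U * V) = V"
    using U V by (simp flip: assoc_mult_mat[of _ n n _ n _ n])
  finally show ?thesis using U V by (simp add: unitary_def)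
qed

section \<open>Diagonal matrices\<close>

definition diagonal :: "nat \<Rightarrow> (nat \<Rightarrow> complex) \<Rightarrow> complex mat" where
  "diagonal n f = mat n n (\<lambda>(i, j). if i = j then f i else 0)"

lemma diagonal_carrier [simp]: "diagonal n f \<in> carrier_mat n n"
  and diagonal_dim [simp]: "dim_row (diagonal n f) = n" "dim_col (diagonal n f) = n"
  and diagonal_index: "i < n \<Longrightarrow> j < n \<Longrightarrow> diagonal n f $$ (i, j) = (if i = j then f i else 0)"
  by (auto simp: diagonal_def)

lemma diagonal_cong: "(\<And>i. i < n \<Longrightarrow> f i = g i) \<Longrightarrow> diagonal n f = diagonal n g"
  by (rule eq_matI) (auto simp: diagonal_index)

lemma diagonal_one: "diagonal n (\<lambda>_. 1) = 1\<^sub>m n"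
  by (rule eq_matI) (auto simp: diagonal_index)

lemma diagonal_mult [simp]: "diagonal n f * diagonal n g = diagonal n (\<lambda>i. f i * g i)"
  by (rule eq_matI)
    (auto simp: diagonal_index mult_mat_index[of _ n n _ n] if_distrib[of "\<lambda>x. x * _"] sum.delta cong: if_cong
      simp del: index_mult_mat(1))

lemma adj_diagonal: "adj (diagonal n f) = diagonal n (\<lambda>i. cnj (f i))"
  by (rule eq_matI) (auto simp: adj_def diagonal_index)

lemma diagonal_mult_vec:
  assumes "v \<in> carrier_vec n"
  shows "diagonal n f *\<^sub>v v = vec n (\<lambda>i. f i * v $ i)"
  by (rule eq_vecI)
    (use assms in \<open>auto simp: diagonal_index mult_mat_vec_index[of _ n n] if_distrib[of "\<lambda>x. x * _"] sum.delta cong: if_cong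
      simp del: index_mult_mat_vec\<close>)

lemma unitary_diagonal:
  assumes "\<And>i. i < n \<Longrightarrow> cmod (f i) = 1"
  shows "unitary n (diagonal n f)"
proof -
  have "cnj (f i) * f i = 1" if "i < n" for i
    using assms[OF that] by (metis complex_norm_square mult.commute of_real_1 one_power2)
  then have "diagonal n (\<lambda>i. cnj (f i) * f i) = diagonal n (\<lambda>_. 1)" by (intro diagonal_cong) auto
  then show ?thesis by (simp add: unitary_def adj_diagonal diagonal_one)
qed

section \<open>Kronecker products in the two-digit index encoding\<close>

lemma kron_dim [simp]: "dim_row (kron A B) = dim_row A * dim_row B" "dim_col (kron A B) = dim_col A * dim_col B"
  by (auto simp: kron_def)

lemma kron_carrier [simp]:
  "A \<in> carrier_mat n m \<Longrightarrow> B \<in> carrier_mat k l \<Longrightarrow> kron A B \<in> carrier_mat (n * k) (m * l)"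
  by (auto simp: kron_def)

lemma kron_index:
  "A \<in> carrier_mat n m \<Longrightarrow> B \<in> carrier_mat k l \<Longrightarrow> i < n * k \<Longrightarrow> j < m * l \<Longrightarrow>
    kron A B $$ (i, j) = A $$ (i div k, j div l) * B $$ (i mod k, j mod l)"
  by (auto simp: kron_def)

lemma kron_mult:
  assumes A: "A \<in> carrier_mat n m" and B: "B \<in> carrier_mat k l"
    and C: "C \<in> carrier_mat m p" and D: "D \<in> carrier_mat l q"
  shows "kron A B * kron C D = kron (A * C) (B * D)"
proof (rule eq_matI)
  note AB = kron_carrier[OF A B] and CD = kron_carrier[OF C D]
  have AC: "A * C \<in> carrier_mat n p" and BD: "B * D \<in> carrier_mat k q" using assms by auto
  fix i j assume "i < dim_row (kron (A * C) (B * D))" "j < dim_col (kron (A * C) (B * D))"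
  then have i: "i < n * k" and j: "j < p * q" using assms by auto
  note ij = div_less_of_mult[OF i] mod_less_of_mult[OF i] div_less_of_mult[OF j] mod_less_of_mult[OF j]
  have "(kron A B * kron C D) $$ (i, j) = (\<Sum>s<m. \<Sum>t<l. kron A B $$ (i, s * l + t) * kron C D $$ (s * l + t, j))"
    by (simp only: mult_mat_index[OF AB CD i j] sum_mult_split)
  also have "\<dots> = (\<Sum>s<m. \<Sum>t<l. (A $$ (i div k, s) * C $$ (s, j div q)) * (B $$ (i mod k, t) * D $$ (t, j mod q)))"
    by (intro sum.cong refl) (use i j in \<open>simp add: kron_index[OF A B] kron_index[OF C D] index_less_mult\<close>)
  also have "\<dots> = (A * C) $$ (i div k, j div q) * (B * D) $$ (i mod k, j mod q)"
    by (simp only: mult_mat_index[OF A C ij(1,3)] mult_mat_index[OF B D ij(2,4)] sum_product)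
  also have "\<dots> = kron (A * C) (B * D) $$ (i, j)"
    using kron_index[OF AC BD i j] by simp
  finally show "(kron A B * kron C D) $$ (i, j) = kron (A * C) (B * D) $$ (i, j)" .
qed (use assms in auto)

lemma adj_kron: "adj (kron A B) = kron (adj A) (adj B)"
  by (rule eq_matI)
    (auto simp: adj_def kron_def div_less_of_mult mod_less_of_mult)

lemma kron_diagonal: "kron (diagonal n f) (diagonal m g) = diagonal (n * m) (\<lambda>i. f (i div m) * g (i mod m))"
proof (rule eq_matI)
  fix i j assume "i < dim_row (diagonal (n * m) (\<lambda>i. f (i div m) * g (i mod m)))"
    "j < dim_col (diagonal (n * m) (\<lambda>i. f (i div m) * g (i mod m)))"
  then have i: "i < n * m" and j: "j < n * m" by auto
  have "i = j \<longleftrightarrow> i div m = j div m \<and> i mod m = j mod m" by (metis mult_div_mod_eq)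
  then show "kron (diagonal n f) (diagonal m g) $$ (i, j) = diagonal (n * m) (\<lambda>i. f (i div m) * g (i mod m)) $$ (i, j)"
    using i j div_less_of_mult[OF i] mod_less_of_mult[OF i] div_less_of_mult[OF j] mod_less_of_mult[OF j]
    by (auto simp: kron_index[of _ n n _ m m] diagonal_index)
qed auto

lemma kron_one: "kron (1\<^sub>m n) (1\<^sub>m m) = 1\<^sub>m (n * m)"
  using kron_diagonal[of n "\<lambda>_. 1" m "\<lambda>_. 1"] by (simp add: diagonal_one)

lemma unitary_kron:
  assumes "unitary n U" "unitary m V"
  shows "unitary (n * m) (kron U V)"
  using unitaryD[OF assms(1)] unitaryD[OF assms(2)]
  by (simp add: unitary_def adj_kron kron_mult[of _ n n _ m m _ n _ m] kron_one)

lemma mult_cancel_middle: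
  fixes A B C D :: "complex mat"
  assumes "A \<in> carrier_mat n n" "B \<in> carrier_mat n n" "C \<in> carrier_mat n n" "D \<in> carrier_mat n n"
    and "B * C = 1\<^sub>m n"
  shows "A * B * (C * D) = A * D"
proof -
  have "A * B * (C * D) = A * (B * (C * D))"
    using assms(1-4) by (intro assoc_mult_mat) auto
  also have "B * (C * D) = B * C * D"
    using assms(1-4) by (intro assoc_mult_mat[symmetric]) auto
  finally show ?thesis using assms by simp
qed

section \<open>Powers and exponentials of unitarily diagonalised matrices\<close>

lemma conj_diagonal_mult:
  assumes "unitary n U"
  shows "(U * diagonal n f * adj U) * (U * diagonal n g * adj U) = U * diagonal n (\<lambda>i. f i * g i) * adj U"
proof -
  note U = unitaryD[OF assms]
  have "(U * diagonal n f * adj U) * (U * diagonal n g * adj U) = (U * diagonal n f * adj U) * (U * (diagonal n g * adj U))"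
    using U by (subst (2) assoc_mult_mat[of _ n n _ n _ n]) auto
  also have "\<dots> = (U * diagonal n f) * (diagonal n g * adj U)"
    by (rule mult_cancel_middle[of _ n]) (use U in auto)
  also have "\<dots> = U * diagonal n f * diagonal n g * adj U"
    using U by (intro assoc_mult_mat[symmetric, of _ n n _ n _ n]) auto
  also have "U * diagonal n f * diagonal n g = U * diagonal n (\<lambda>i. f i * g i)"
    using U by (subst assoc_mult_mat[of _ n n _ n _ n]) auto
  finally show ?thesis .
qed

lemma conj_pow:
  assumes "unitary n U"
  shows "(c \<cdot>\<^sub>m (U * diagonal n f * adj U)) ^\<^sub>m k = U * diagonal n (\<lambda>i. (c * f i) ^ k) * adj U"
proof (induction k)
  case 0
  show ?case using unitaryD[OF assms] by (simp add: diagonal_one)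
next
  case (Suc k)
  note U = unitaryD[OF assms]
  have eq: "c \<cdot>\<^sub>m (U * diagonal n f * adj U) = U * diagonal n (\<lambda>i. c * f i) * adj U"
  proof -
    have "c \<cdot>\<^sub>m diagonal n f = diagonal n (\<lambda>i. c * f i)" by (rule eq_matI) (auto simp: diagonal_index)
    then show ?thesis
      using U mult_smult_assoc_mat[of "U * diagonal n f" n n "adj U" n c] mult_smult_distrib[of U n n "diagonal n f" n c]
      by simp
  qed
  have "(c \<cdot>\<^sub>m (U * diagonal n f * adj U)) ^\<^sub>m Suc k
      = (U * diagonal n (\<lambda>i. (c * f i) ^ k) * adj U) * (U * diagonal n (\<lambda>i. c * f i) * adj U)"
    using Suc eq by simp
  then show ?case by (simp add: conj_diagonal_mult[OF assms] mult.commute)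
qed

lemma conj_diagonal_index:
  assumes "unitary n U" "i < n" "j < n"
  shows "(U * diagonal n f * adj U) $$ (i, j) = (\<Sum>l<n. U $$ (i, l) * f l * cnj (U $$ (j, l)))"
proof -
  note U = unitaryD[OF assms(1)]
  have "(U * diagonal n f) $$ (i, l) = U $$ (i, l) * f l" if "l < n" for l
    using U(1) that assms
    by (subst mult_mat_index[of _ n n _ n])
      (auto simp: diagonal_index if_distrib[of "\<lambda>x. _ * x"] sum.delta' cong: if_cong)
  then show ?thesis
    using U assms by (subst mult_mat_index[of _ n n _ n]) (auto simp: adj_index[OF U(1)] intro!: sum.cong)
qed

text \<open>Entrywise, the defining series is a fixed finite combination, over the eigenvalue index
  l, of scalar exponential series, so it may be summed term by term.\<close>

lemma mexp_conj:
  assumes "unitary n U"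
  shows "mexp (c \<cdot>\<^sub>m (U * diagonal n f * adj U)) = U * diagonal n (\<lambda>i. exp (c * f i)) * adj U"
proof (rule eq_matI)
  note U = unitaryD[OF assms]
  fix i j assume "i < dim_row (U * diagonal n (\<lambda>i. exp (c * f i)) * adj U)" "j < dim_col (U * diagonal n (\<lambda>i. exp (c * f i)) * adj U)"
  then have ij: "i < n" "j < n" using U by auto
  have "(\<lambda>k. ((c \<cdot>\<^sub>m (U * diagonal n f * adj U)) ^\<^sub>m k) $$ (i, j) / of_nat (fact k))
      = (\<lambda>k. \<Sum>l<n. U $$ (i, l) * ((c * f l) ^ k /\<^sub>R fact k) * cnj (U $$ (j, l)))"
    by (rule ext) (simp only: conj_pow[OF assms] conj_diagonal_index[OF assms ij] sum_divide_distrib,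
      rule sum.cong, auto simp: scaleR_conv_of_real field_simps)
  moreover have "\<dots> sums (\<Sum>l<n. U $$ (i, l) * exp (c * f l) * cnj (U $$ (j, l)))"
    by (intro sums_sum sums_mult sums_mult2 exp_converges)
  ultimately have "(\<Sum>k. ((c \<cdot>\<^sub>m (U * diagonal n f * adj U)) ^\<^sub>m k) $$ (i, j) / of_nat (fact k))
      = (U * diagonal n (\<lambda>i. exp (c * f i)) * adj U) $$ (i, j)"
    by (simp only: conj_diagonal_index[OF assms ij] sums_iff)
  then show "mexp (c \<cdot>\<^sub>m (U * diagonal n f * adj U)) $$ (i, j) = (U * diagonal n (\<lambda>i. exp (c * f i)) * adj U) $$ (i, j)"
    using ij U by (subst mexp_def, subst index_mat(1)) (simp_all del: index_mult_mat(1))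
qed (use unitaryD[OF assms] in \<open>auto simp: mexp_def\<close>)

section \<open>The spectral theorem for Hermitian matrices\<close>

lemma hermitian_index:
  assumes "hermitian n A" "i < n" "j < n"
  shows "A $$ (j, i) = cnj (A $$ (i, j))"
  using assms adj_index[of A n n j i] by (auto simp: hermitian_def)

lemma hermitian_conj:
  assumes "hermitian n A" "unitary n U"
  shows "hermitian n (adj U * A * U)"
proof -
  note U = unitaryD[OF assms(2)]
  have A: "A \<in> carrier_mat n n" "adj A = A" using assms(1) by (auto simp: hermitian_def)
  have "adj (adj U * A * U) = adj U * adj (adj U * A)"
    using U A by (intro adj_mult) auto
  also have "adj (adj U * A) = A * U"
    using adj_mult[OF U(2) A(1)] A(2) by simp
  also have "adj U * (A * U) = adj U * A * U"
    using U A by (intro assoc_mult_mat[symmetric, of _ n n _ n _ n]) auto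
  finally have "adj (adj U * A * U) = adj U * A * U" .
  moreover have "adj U * A * U \<in> carrier_mat n n" using U A by simp
  ultimately show ?thesis by (simp only: hermitian_def)
qed

text \<open>Gram-Schmidt returns orthogonal but unnormalised vectors, so each column is divided by
  its norm; \<open>corthogonal\<close> at equal indices shows that this norm is nonzero.\<close>

lemma unitary_of_orthogonal_basis:
  assumes ws: "set ws \<subseteq> carrier_vec n" "corthogonal ws" "length ws = n"
  shows "unitary n (mat n n (\<lambda>(i, j). ws ! j $ i / vnorm (ws ! j)))"
proof -
  let ?U = "mat n n (\<lambda>(i, j). ws ! j $ i / vnorm (ws ! j))"
  have dim: "dim_vec (ws ! j) = n" if "j < n" for j
    using ws that by (metis carrier_vecD nth_mem subsetD)
  have norm: "(\<Sum>l<n. cnj (ws ! j $ l) * ws ! j $ l) = (complex_of_real (vnorm (ws ! j)))\<^sup>2" if "j < n" for j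
  proof -
    have "(complex_of_real (vnorm (ws ! j)))\<^sup>2 = of_real (\<Sum>l<n. (cmod (ws ! j $ l))\<^sup>2)"
      using dim[OF that] by (simp add: vnorm_def sum_nonneg flip: of_real_power)
    then show ?thesis by (simp add: complex_norm_square mult.commute del: of_real_power)
  qed
  have "(adj ?U * ?U) $$ (i, j) = 1\<^sub>m n $$ (i, j)" if "i < n" "j < n" for i j
  proof -
    have ip: "(\<Sum>l<n. cnj (ws ! i $ l) * ws ! j $ l) = ws ! j \<bullet> conjugate (ws ! i)"
      using dim that by (simp add: scalar_prod_def lessThan_atLeast0 mult.commute)
    have "(adj ?U * ?U) $$ (i, j) = (\<Sum>l<n. adj ?U $$ (i, l) * ?U $$ (l, j))"
      using that by (intro mult_mat_index) auto
    also have "\<dots> = (\<Sum>l<n. cnj (ws ! i $ l) * ws ! j $ l) / (vnorm (ws ! i) * vnorm (ws ! j))"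
      unfolding sum_divide_distrib using that by (intro sum.cong) (auto simp: adj_index[of _ n n])
    also have "\<dots> = (if i = j then 1 else 0)"
    proof (cases "i = j")
      case True
      have "ws ! j \<bullet> conjugate (ws ! j) \<noteq> 0"
        using corthogonalD[OF ws(2), of j j] that ws(3) by simp
      then have "vnorm (ws ! j) \<noteq> 0" using ip norm[OF that(2)] True by auto
      then show ?thesis using True norm[OF that(2)] by (simp add: power2_eq_square)
    next
      case False
      then show ?thesis using ip corthogonalD[OF ws(2), of j i] that ws(3) by simp
    qed
    finally show ?thesis using that by simp
  qed
  then have "adj ?U * ?U = 1\<^sub>m n" by (intro eq_matI) (auto simp del: index_mult_mat(1))
  then show ?thesis by (simp add: unitary_def)
qed

text \<open>The deflation step of the spectral theorem. An eigenvector is completed to a basis;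
  Gram-Schmidt leaves the first vector unchanged, so column 0 of U is a normalised
  eigenvector.\<close>

lemma unitary_with_eigenvector_column:
  fixes A :: "complex mat"
  assumes A: "A \<in> carrier_mat n n" and n: "0 < n"
  shows "\<exists>U e. unitary n U \<and> (\<forall>i<n. (adj U * A * U) $$ (i, 0) = (if i = 0 then e else 0))"
proof -
  from spectrum_non_empty[OF A n] obtain e v where ev: "eigenvector A v e"
    unfolding spectrum_def eigenvalue_def by auto
  then have v: "v \<in> carrier_vec n" "v \<noteq> 0\<^sub>v n" "A *\<^sub>v v = e \<cdot>\<^sub>v v"
    using A unfolding eigenvector_def by auto
  interpret cof_vec_space n "TYPE(complex)" .
  define b where "b = basis_completion v"
  note bc = basis_completion[OF v(1,2), folded b_def]
  define ws where "ws = gram_schmidt n b"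
  from bc(6,7) n obtain vs where bv: "b = v # vs" by (cases b) auto
  from gram_schmidt_result[OF bc(2,4,5) ws_def] bc(6)
  have ws: "set ws \<subseteq> carrier_vec n" "corthogonal ws" "length ws = n" by auto
  have "hd ws = v" using gram_schmidt_hd[OF v(1), of vs] by (simp add: ws_def bv)
  then have ws0: "ws ! 0 = v" using ws(3) n by (metis hd_conv_nth length_0_conv less_nat_zero_code)
  define U where "U = mat n n (\<lambda>(i, j). ws ! j $ i / vnorm (ws ! j))"
  have uU: "unitary n U" unfolding U_def by (rule unitary_of_orthogonal_basis[OF ws])
  note U = unitaryD[OF uU]
  have AU: "(A * U) $$ (i, 0) = e * U $$ (i, 0)" if "i < n" for i
  proof -
    have "(A * U) $$ (i, 0) = (\<Sum>l<n. A $$ (i, l) * U $$ (l, 0))"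
      using A U n that by (intro mult_mat_index) auto
    also have "\<dots> = (\<Sum>l<n. A $$ (i, l) * v $ l) / vnorm v"
      unfolding sum_divide_distrib using n ws0 by (intro sum.cong) (auto simp: U_def)
    also have "(\<Sum>l<n. A $$ (i, l) * v $ l) = e * v $ i"
      using mult_mat_vec_index[OF A v(1) that] v that by simp
    finally show ?thesis using that n ws0 by (simp add: U_def)
  qed
  have "(adj U * A * U) $$ (i, 0) = (if i = 0 then e else 0)" if "i < n" for i
  proof -
    have "(adj U * A * U) $$ (i, 0) = (adj U * (A * U)) $$ (i, 0)"
      using U A by (subst assoc_mult_mat[of _ n n _ n _ n]) auto
    also have "\<dots> = (\<Sum>l<n. adj U $$ (i, l) * (A * U) $$ (l, 0))"
      using U A that n by (intro mult_mat_index) auto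
    also have "\<dots> = (\<Sum>l<n. e * (adj U $$ (i, l) * U $$ (l, 0)))"
      using AU by (intro sum.cong) auto
    also have "\<dots> = e * (adj U * U) $$ (i, 0)"
      unfolding sum_distrib_left[symmetric] using U that n by (subst mult_mat_index[of _ n n _ n]) auto
    finally show ?thesis using U that n by simp
  qed
  with uU show ?thesis by blast
qed

text \<open>Induction on the dimension by deflation: conjugation preserves Hermiticity, so the
  cleared first column forces a cleared first row, and the remaining block is Hermitian of size
  n.\<close>

lemma hermitian_diagonalizable:
  "hermitian n A \<Longrightarrow> \<exists>U x. unitary n U \<and> A = U * diagonal n (\<lambda>i. complex_of_real (x i)) * adj U"
proof (induction n arbitrary: A)
  case 0
  then show ?case by (intro exI[of _ "1\<^sub>m 0"]) (auto simp: hermitian_def intro!: eq_matI)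
next
  case (Suc n A)
  have A: "A \<in> carrier_mat (Suc n) (Suc n)" using Suc.prems by (auto simp: hermitian_def)
  obtain V e where V: "unitary (Suc n) V"
    and col: "\<And>i. i < Suc n \<Longrightarrow> (adj V * A * V) $$ (i, 0) = (if i = 0 then e else 0)"
    using unitary_with_eigenvector_column[OF A] by blast
  define B where "B = adj V * A * V"
  have hB: "hermitian (Suc n) B" unfolding B_def by (rule hermitian_conj[OF Suc.prems V])
  have Bc: "B \<in> carrier_mat (Suc n) (Suc n)" using hB by (auto simp: hermitian_def)
  note uV = unitaryD[OF V]
  have col0: "B $$ (i, 0) = (if i = 0 then e else 0)" if "i < Suc n" for i
    using col[OF that] by (simp add: B_def)
  have row0: "B $$ (0, i) = (if i = 0 then e else 0)" if "i < Suc n" for i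
    using hermitian_index[OF hB that, of 0] col0[OF that] col0[of 0] hermitian_index[OF hB, of 0 0]
    by (auto split: if_splits)
  \<comment> \<open>A diagonal entry of a Hermitian matrix is real; this is where the reality of the
    eigenvalues comes from.\<close>
  have e: "e = complex_of_real (Re e)"
    using hermitian_index[OF hB, of 0 0] col0[of 0] by (simp add: complex_eq_iff)
  define C where "C = mat n n (\<lambda>(i, j). B $$ (Suc i, Suc j))"
  have hC: "hermitian n C"
  proof -
    have "adj C $$ (i, j) = C $$ (i, j)" if "i < n" "j < n" for i j
      using hermitian_index[OF hB, of "Suc j" "Suc i"] that by (simp add: adj_def C_def)
    then have "adj C = C" by (intro eq_matI) (auto simp: C_def)
    then show ?thesis by (simp add: hermitian_def C_def)
  qed
  obtain W y where W: "unitary n W" and Ceq: "C = W * diagonal n (\<lambda>i. complex_of_real (y i)) * adj W"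
    using Suc.IH[OF hC] by blast
  note uW = unitaryD[OF W]
  \<comment> \<open>\<open>W'\<close> is the block sum of 1 and \<open>W\<close>; accordingly index
    0 carries the deflated eigenvalue and the others shift by one.\<close>
  define x where "x = case_nat (Re e) y"
  define W' where "W' = mat (Suc n) (Suc n) (\<lambda>(i, j).
     case (i, j) of (Suc i, Suc j) \<Rightarrow> W $$ (i, j) | (0, 0) \<Rightarrow> 1 | _ \<Rightarrow> 0)"
  have W'c: "W' \<in> carrier_mat (Suc n) (Suc n)" by (simp add: W'_def)
  have W'i: "W' $$ (0, 0) = 1" "\<And>i. i < n \<Longrightarrow> W' $$ (Suc i, 0) = 0" "\<And>i. i < n \<Longrightarrow> W' $$ (0, Suc i) = 0"
    "\<And>i j. i < n \<Longrightarrow> j < n \<Longrightarrow> W' $$ (Suc i, Suc j) = W $$ (i, j)"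
    by (auto simp: W'_def)
  have W'u: "unitary (Suc n) W'"
  proof -
    have ent: "(\<Sum>l<n. cnj (W $$ (l, i)) * W $$ (l, j)) = (if i = j then 1 else 0)" if "i < n" "j < n" for i j
    proof -
      have "(adj W * W) $$ (i, j) = (\<Sum>l<n. cnj (W $$ (l, i)) * W $$ (l, j))"
        using uW that by (subst mult_mat_index[of _ n n _ n]) (auto simp: adj_index[OF uW(1)] intro!: sum.cong)
      then show ?thesis using uW that by simp
    qed
    have "(adj W' * W') $$ (i, j) = 1\<^sub>m (Suc n) $$ (i, j)" if "i < Suc n" "j < Suc n" for i j
    proof -
      have "(adj W' * W') $$ (i, j) = (\<Sum>l<Suc n. cnj (W' $$ (l, i)) * W' $$ (l, j))"
        using W'c that by (subst mult_mat_index[of _ "Suc n" "Suc n" _ "Suc n"])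
          (auto simp: adj_index[OF W'c] intro!: sum.cong)
      also have "\<dots> = (if i = j then 1 else 0)"
        using that ent by (cases i; cases j) (auto simp: sum.lessThan_Suc_shift W'i simp del: sum.lessThan_Suc)
      finally show ?thesis using that by simp
    qed
    then have "adj W' * W' = 1\<^sub>m (Suc n)" using W'c by (intro eq_matI) (auto simp del: index_mult_mat(1))
    then show ?thesis using W'c by (simp add: unitary_def)
  qed
  note uW' = unitaryD[OF W'u]
  have Beq: "B = W' * diagonal (Suc n) (\<lambda>i. complex_of_real (x i)) * adj W'"
  proof (rule eq_matI)
    fix i j assume "i < dim_row (W' * diagonal (Suc n) (\<lambda>i. complex_of_real (x i)) * adj W')"
      "j < dim_col (W' * diagonal (Suc n) (\<lambda>i. complex_of_real (x i)) * adj W')"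
    then have ij: "i < Suc n" "j < Suc n" using W'c by auto
    have "B $$ (Suc i, Suc j) = (\<Sum>l<n. W $$ (i, l) * complex_of_real (y l) * cnj (W $$ (j, l)))"
      if "i < n" "j < n" for i j
      using conj_diagonal_index[OF W that, of "\<lambda>i. complex_of_real (y i)"] that
      by (simp flip: Ceq) (simp add: C_def)
    then show "B $$ (i, j) = (W' * diagonal (Suc n) (\<lambda>i. complex_of_real (x i)) * adj W') $$ (i, j)"
      unfolding conj_diagonal_index[OF W'u ij]
      using ij col0[of i] row0[of j] e
      by (cases i; cases j) (auto simp: sum.lessThan_Suc_shift W'i x_def simp del: sum.lessThan_Suc)
  qed (use Bc W'c in auto)
  have "A = V * B * adj V"
  proof -
    have "V * B * adj V = V * (adj V * (A * V)) * adj V"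
      using uV A by (simp add: B_def assoc_mult_mat[of _ "Suc n" "Suc n" _ "Suc n" _ "Suc n"])
    also have "V * (adj V * (A * V)) = V * adj V * (A * V)"
      using uV A by (intro assoc_mult_mat[symmetric, of _ "Suc n" "Suc n" _ "Suc n" _ "Suc n"]) auto
    also have "\<dots> = A * V" using uV A by simp
    also have "A * V * adj V = A * (V * adj V)"
      using uV A by (intro assoc_mult_mat[of _ "Suc n" "Suc n" _ "Suc n" _ "Suc n"]) auto
    finally show ?thesis using uV A by simp
  qed
  also have "\<dots> = (V * W') * diagonal (Suc n) (\<lambda>i. complex_of_real (x i)) * adj (V * W')"
    using uV uW' by (simp add: Beq adj_mult[of _ "Suc n" "Suc n" _ "Suc n"]
        assoc_mult_mat[of _ "Suc n" "Suc n" _ "Suc n" _ "Suc n"])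
  finally show ?case using unitary_mult[OF V W'u] by blast
qed

text \<open>Connects the spectrum used in \<open>spread\<close> with the diagonal entries: similar
  matrices share their characteristic polynomial, and that of a diagonal matrix factors
  visibly.\<close>

lemma eigenvalues_conj_diagonal:
  assumes "unitary n U"
  shows "Collect (eigenvalue (U * diagonal n f * adj U)) = f ` {..<n}"
proof -
  note U = unitaryD[OF assms]
  let ?A = "U * diagonal n f * adj U"
  have A: "?A \<in> carrier_mat n n" using U by simp
  have "similar_mat ?A (diagonal n f)"
    unfolding similar_mat_def by (intro exI[of _ U] exI[of _ "adj U"] similar_mat_witI[of _ _ n]) (use U in auto)
  then have "char_poly ?A = char_poly (diagonal n f)" by (rule char_poly_similar)
  also have "\<dots> = (\<Prod>a\<leftarrow>diag_mat (diagonal n f). [:- a, 1:])"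
    by (rule char_poly_upper_triangular[of _ n]) (auto simp: diagonal_index)
  also have "diag_mat (diagonal n f) = map f [0..<n]"
    by (auto simp: diag_mat_def diagonal_index)
  finally have cp: "char_poly ?A = (\<Prod>a\<leftarrow>map f [0..<n]. [:- a, 1:])" .
  have "poly (char_poly ?A) a = 0 \<longleftrightarrow> a \<in> f ` {..<n}" for a
    unfolding cp by (auto simp: poly_prod_list_zero_iff)
  then show ?thesis unfolding eigenvalue_root_char_poly[OF A] by auto
qed

text \<open>Positive dimension makes the spectrum nonempty, so both extremes are attained. The
  indices p and q later select the extremal eigenvectors.\<close>

lemma hermitian_spectral_spread:
  assumes "hermitian n A" "0 < n"
  shows "\<exists>U x p q. unitary n U \<and> A = U * diagonal n (\<lambda>i. complex_of_real (x i)) * adj U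
     \<and> p < n \<and> q < n \<and> (\<forall>i<n. x q \<le> x i \<and> x i \<le> x p) \<and> spread A = x p - x q"
proof -
  obtain U x where U: "unitary n U" and A: "A = U * diagonal n (\<lambda>i. complex_of_real (x i)) * adj U"
    using hermitian_diagonalizable[OF assms(1)] by blast
  have ev: "Re ` Collect (eigenvalue A) = x ` {..<n}"
    unfolding A eigenvalues_conj_diagonal[OF U] by (auto simp: image_image)
  have fin: "finite (x ` {..<n})" "x ` {..<n} \<noteq> {}" using assms(2) by auto
  obtain p where p: "p < n" "x p = Max (x ` {..<n})" using Max_in[OF fin] by auto
  obtain q where q: "q < n" "x q = Min (x ` {..<n})" using Min_in[OF fin] by auto
  have "x q \<le> x i \<and> x i \<le> x p" if "i < n" for i
    using p q fin that by auto
  moreover have "spread A = x p - x q" unfolding spread_def ev using p q by simp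
  ultimately show ?thesis using U A p q by blast
qed

section \<open>Evolutions close to local unitaries\<close>

lemma kron_conj_diagonal:
  assumes "unitary n P" "unitary m Q"
  shows "kron (P * diagonal n f * adj P) (Q * diagonal m g * adj Q)
    = kron P Q * diagonal (n * m) (\<lambda>i. f (i div m) * g (i mod m)) * adj (kron P Q)"
proof -
  note P = unitaryD[OF assms(1)] and Q = unitaryD[OF assms(2)]
  show ?thesis
    using P Q
    by (simp add: adj_kron kron_diagonal[symmetric] kron_mult[of _ n n _ m m _ n _ m])
qed

lemma kron_one_conj_diagonal:
  assumes "unitary n U"
  shows "kron (U * diagonal n f * adj U) (1\<^sub>m r)
    = kron U (1\<^sub>m r) * diagonal (n * r) (\<lambda>i. f (i div r)) * adj (kron U (1\<^sub>m r))"
  using kron_conj_diagonal[OF assms unitary_one[of r], of f "\<lambda>_. 1"] by (simp add: diagonal_one)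

lemma mult_mat_vec_square_carrier [simp]:
  "A \<in> carrier_mat n n \<Longrightarrow> v \<in> carrier_vec n \<Longrightarrow> A *\<^sub>v v \<in> carrier_vec n"
  by (rule mult_mat_vec_carrier)

text \<open>Ancillas only repeat the eigenvalues of each factor. The lifted resource is again a
  product with the same local spectra, which is why ancillas cannot improve the upper bound.\<close>

lemma lift_ham_kron:
  assumes "HA \<in> carrier_mat dA dA" "HB \<in> carrier_mat dB dB"
  shows "lift_ham dA dB (kron HA HB) ra rb = kron (kron HA (1\<^sub>m ra)) (kron HB (1\<^sub>m rb))"
proof (rule eq_matI)
  fix i j assume "i < dim_row (kron (kron HA (1\<^sub>m ra)) (kron HB (1\<^sub>m rb)))"
    "j < dim_col (kron (kron HA (1\<^sub>m ra)) (kron HB (1\<^sub>m rb)))"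
  then have ij: "i < dA * ra * (dB * rb)" "j < dA * ra * (dB * rb)" using assms by auto
  have A: "i div (dB * rb) < dA * ra" "j div (dB * rb) < dA * ra"
    using ij by (auto intro: div_less_of_mult)
  have B: "i mod (dB * rb) < dB * rb" "j mod (dB * rb) < dB * rb"
    using ij by (auto intro: mod_less_of_mult)
  note less = A[THEN div_less_of_mult] A[THEN mod_less_of_mult] B[THEN div_less_of_mult] B[THEN mod_less_of_mult]
  show "lift_ham dA dB (kron HA HB) ra rb $$ (i, j) = kron (kron HA (1\<^sub>m ra)) (kron HB (1\<^sub>m rb)) $$ (i, j)"
    using ij A B less assms
    by (auto simp: lift_ham_def Let_def kron_index[of _ "dA * ra" "dA * ra" _ "dB * rb" "dB * rb"]
        kron_index[of _ dA dA _ ra ra] kron_index[of _ dB dB _ rb rb] kron_index[of _ dA dA _ dB dB] index_less_mult)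
qed (use assms in \<open>auto simp: lift_ham_def\<close>)

section \<open>Product vectors, inner products and the Euclidean norm\<close>

definition kronv :: "complex vec \<Rightarrow> complex vec \<Rightarrow> complex vec" where
  "kronv u v = vec (dim_vec u * dim_vec v) (\<lambda>i. u $ (i div dim_vec v) * v $ (i mod dim_vec v))"

lemma kronv_carrier [simp]: "u \<in> carrier_vec n \<Longrightarrow> v \<in> carrier_vec m \<Longrightarrow> kronv u v \<in> carrier_vec (n * m)"
  by (auto simp: kronv_def)

lemma kronv_index: "u \<in> carrier_vec n \<Longrightarrow> v \<in> carrier_vec m \<Longrightarrow> i < n * m \<Longrightarrow>
    kronv u v $ i = u $ (i div m) * v $ (i mod m)"
  by (auto simp: kronv_def)

lemma kron_mult_kronv:
  assumes A: "A \<in> carrier_mat n m" and B: "B \<in> carrier_mat k l"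
    and u: "u \<in> carrier_vec m" and v: "v \<in> carrier_vec l"
  shows "kron A B *\<^sub>v kronv u v = kronv (A *\<^sub>v u) (B *\<^sub>v v)"
proof (rule eq_vecI)
  have Au: "A *\<^sub>v u \<in> carrier_vec n" and Bv: "B *\<^sub>v v \<in> carrier_vec k" using assms by auto
  fix i assume "i < dim_vec (kronv (A *\<^sub>v u) (B *\<^sub>v v))"
  then have i: "i < n * k" using A B by (simp add: kronv_def)
  note il = div_less_of_mult[OF i] mod_less_of_mult[OF i]
  have "(kron A B *\<^sub>v kronv u v) $ i = (\<Sum>s<m. \<Sum>t<l. kron A B $$ (i, s * l + t) * kronv u v $ (s * l + t))"
    by (simp only: mult_mat_vec_index[OF kron_carrier[OF A B] kronv_carrier[OF u v] i] sum_mult_split)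
  also have "\<dots> = (\<Sum>s<m. \<Sum>t<l. (A $$ (i div k, s) * u $ s) * (B $$ (i mod k, t) * v $ t))"
    by (intro sum.cong refl) (use i in \<open>simp add: kron_index[OF A B] kronv_index[OF u v] index_less_mult\<close>)
  also have "\<dots> = (A *\<^sub>v u) $ (i div k) * (B *\<^sub>v v) $ (i mod k)"
    by (simp only: mult_mat_vec_index[OF A u il(1)] mult_mat_vec_index[OF B v il(2)] sum_product)
  finally show "(kron A B *\<^sub>v kronv u v) $ i = kronv (A *\<^sub>v u) (B *\<^sub>v v) $ i"
    using kronv_index[OF Au Bv i] by simp
qed (use assms in \<open>auto simp: kronv_def\<close>)

definition cinner :: "complex vec \<Rightarrow> complex vec \<Rightarrow> complex" where
  "cinner u v = (\<Sum>i<dim_vec v. cnj (u $ i) * v $ i)"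

lemma vnorm_nonneg [simp]: "0 \<le> vnorm v"
  by (simp add: vnorm_def sum_nonneg)

lemma vnorm_power2: "v \<in> carrier_vec n \<Longrightarrow> (vnorm v)\<^sup>2 = (\<Sum>i<n. (cmod (v $ i))\<^sup>2)"
  by (auto simp: vnorm_def sum_nonneg)

lemma cinner_self: "cinner v v = complex_of_real ((vnorm v)\<^sup>2)"
proof -
  have "complex_of_real ((vnorm v)\<^sup>2) = (\<Sum>i<dim_vec v. complex_of_real ((cmod (v $ i))\<^sup>2))"
    using vnorm_power2[of v "dim_vec v"] by simp
  then show ?thesis by (simp add: cinner_def complex_norm_square mult.commute del: of_real_power)
qed

lemma cinner_adj:
  assumes A: "A \<in> carrier_mat n m" and u: "u \<in> carrier_vec m" and v: "v \<in> carrier_vec n"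
  shows "cinner (A *\<^sub>v u) v = cinner u (adj A *\<^sub>v v)"
proof -
  have "cinner (A *\<^sub>v u) v = (\<Sum>i<n. \<Sum>j<m. cnj (A $$ (i, j)) * cnj (u $ j) * v $ i)"
    unfolding cinner_def using v
    by (auto simp: mult_mat_vec_index[OF A u] sum_distrib_right simp del: index_mult_mat_vec intro!: sum.cong)
  also have "\<dots> = (\<Sum>j<m. \<Sum>i<n. cnj (A $$ (i, j)) * cnj (u $ j) * v $ i)"
    by (rule sum.swap)
  also have "\<dots> = cinner u (adj A *\<^sub>v v)"
    unfolding cinner_def using A v
    by (auto simp: mult_mat_vec_index[OF adj_carrier[OF A] v] adj_index[OF A] sum_distrib_left
        simp del: index_mult_mat_vec intro!: sum.cong)
  finally show ?thesis .
qed

lemma cinner_unitary: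
  assumes "unitary n U" "u \<in> carrier_vec n" "v \<in> carrier_vec n"
  shows "cinner (U *\<^sub>v u) (U *\<^sub>v v) = cinner u v"
proof -
  note U = unitaryD[OF assms(1)]
  have "adj U *\<^sub>v (U *\<^sub>v v) = (adj U * U) *\<^sub>v v"
    using U assms(3) by (intro assoc_mult_mat_vec[symmetric]) auto
  then show ?thesis using U assms by (simp add: cinner_adj[OF U(1) assms(2)])
qed

lemma vnorm_unitary:
  assumes "unitary n U" "v \<in> carrier_vec n"
  shows "vnorm (U *\<^sub>v v) = vnorm v"
proof -
  have "complex_of_real ((vnorm (U *\<^sub>v v))\<^sup>2) = complex_of_real ((vnorm v)\<^sup>2)"
    using cinner_unitary[OF assms(1,2,2)] by (simp only: cinner_self)
  then have "(vnorm (U *\<^sub>v v))\<^sup>2 = (vnorm v)\<^sup>2" by (simp only: of_real_eq_iff)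
  then show ?thesis by (simp add: power2_eq_iff_nonneg)
qed

lemma vnorm_L2_set: "v \<in> carrier_vec n \<Longrightarrow> vnorm v = L2_set (\<lambda>i. cmod (v $ i)) {..<n}"
  by (auto simp: vnorm_def L2_set_def)

lemma vnorm_triangle:
  assumes "u \<in> carrier_vec n" "v \<in> carrier_vec n"
  shows "vnorm (u + v) \<le> vnorm u + vnorm v"
proof -
  have "vnorm (u + v) = L2_set (\<lambda>i. cmod (u $ i + v $ i)) {..<n}"
    using assms by (subst vnorm_L2_set[of _ n]) (auto intro!: L2_set_cong)
  also have "\<dots> \<le> L2_set (\<lambda>i. cmod (u $ i) + cmod (v $ i)) {..<n}"
    by (intro L2_set_mono norm_triangle_ineq) auto
  also have "\<dots> \<le> vnorm u + vnorm v"
    using L2_set_triangle_ineq assms by (simp add: vnorm_L2_set[of _ n])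
  finally show ?thesis .
qed

lemma vnorm_triangle_diff:
  assumes "u \<in> carrier_vec n" "v \<in> carrier_vec n" "w \<in> carrier_vec n"
  shows "vnorm (u - w) \<le> vnorm (u - v) + vnorm (v - w)"
proof -
  have "u - w = (u - v) + (v - w)" using assms by (intro eq_vecI) auto
  then show ?thesis using vnorm_triangle[of "u - v" n "v - w"] assms by simp
qed

lemma vnorm_minus_commute:
  assumes "u \<in> carrier_vec n" "v \<in> carrier_vec n"
  shows "vnorm (u - v) = vnorm (v - u)"
proof -
  have "vnorm (u - v) = L2_set (\<lambda>i. cmod (u $ i - v $ i)) {..<n}"
    using assms by (subst vnorm_L2_set[of _ n]) (auto intro!: L2_set_cong)
  also have "\<dots> = vnorm (v - u)"
    using assms by (subst vnorm_L2_set[of _ n]) (auto intro!: L2_set_cong simp: norm_minus_commute)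
  finally show ?thesis .
qed

lemma vnorm_diagonal_le:
  assumes v: "v \<in> carrier_vec n" and f: "\<And>i. i < n \<Longrightarrow> cmod (f i) \<le> c" and c: "0 \<le> c"
  shows "vnorm (diagonal n f *\<^sub>v v) \<le> c * vnorm v"
proof -
  have "vnorm (diagonal n f *\<^sub>v v) = L2_set (\<lambda>i. cmod (f i) * cmod (v $ i)) {..<n}"
    using v by (subst vnorm_L2_set[of _ n]) (auto simp: diagonal_mult_vec norm_mult intro!: L2_set_cong)
  also have "\<dots> \<le> L2_set (\<lambda>i. c * cmod (v $ i)) {..<n}"
    by (intro L2_set_mono mult_right_mono) (auto intro: f)
  also have "\<dots> = c * vnorm v"
    using v c by (simp add: vnorm_L2_set[of _ n] L2_set_right_distrib)
  finally show ?thesis .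
qed

lemma vnorm_kronv:
  assumes "u \<in> carrier_vec n" "v \<in> carrier_vec m"
  shows "vnorm (kronv u v) = vnorm u * vnorm v"
proof -
  have "(vnorm (kronv u v))\<^sup>2 = (\<Sum>i<n. \<Sum>j<m. (cmod (u $ i))\<^sup>2 * (cmod (v $ j))\<^sup>2)"
    unfolding vnorm_power2[OF kronv_carrier[OF assms]] sum_mult_split
    by (intro sum.cong refl) (simp add: kronv_index[OF assms] index_less_mult norm_mult power_mult_distrib)
  also have "\<dots> = (vnorm u * vnorm v)\<^sup>2"
    by (simp add: vnorm_power2[OF assms(1)] vnorm_power2[OF assms(2)] sum_product power_mult_distrib)
  finally show ?thesis by (simp add: power2_eq_iff_nonneg)
qed

lemma cmod_diff_power2: "(cmod (x - y))\<^sup>2 = (cmod x)\<^sup>2 + (cmod y)\<^sup>2 - 2 * Re (cnj x * y)"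
  unfolding cmod_power2 by (simp add: power2_eq_square algebra_simps)

text \<open>For unit vectors the squared distance is 2 - 2 Re <u, w>, so a small overlap forces a
  large distance.\<close>

lemma vnorm_diff_ge:
  assumes u: "u \<in> carrier_vec n" "vnorm u = 1" and w: "w \<in> carrier_vec n" "vnorm w = 1"
    and c: "cmod (cinner u w) \<le> c"
  shows "2 - 2 * c \<le> (vnorm (u - w))\<^sup>2"
proof -
  have "(vnorm (u - w))\<^sup>2 = (\<Sum>i<n. (cmod (u $ i))\<^sup>2 + (cmod (w $ i))\<^sup>2 - 2 * Re (cnj (u $ i) * w $ i))"
    using u w by (subst vnorm_power2[of _ n]) (auto simp: cmod_diff_power2 intro!: sum.cong)
  also have "\<dots> = (vnorm u)\<^sup>2 + (vnorm w)\<^sup>2 - 2 * Re (cinner u w)"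
    unfolding vnorm_power2[OF u(1)] vnorm_power2[OF w(1)] cinner_def using w(1)
    by (simp add: sum.distrib sum_subtractf sum_distrib_left)
  finally show ?thesis using u w c complex_Re_le_cmod[of "cinner u w"] by simp
qed

text \<open>The chord between two points of the unit circle has length 2 |sin((a - b) / 2)| and is
  no longer than the arc.\<close>

lemma cmod_exp_diff_le: "cmod (exp (\<i> * complex_of_real a) - exp (\<i> * complex_of_real b)) \<le> \<bar>a - b\<bar>"
proof -
  have "(cmod (exp (\<i> * complex_of_real a) - exp (\<i> * complex_of_real b)))\<^sup>2 = 2 - 2 * cos (a - b)"
    by (simp add: cmod_diff_power2 exp_eq_polar cos_diff)
  also have "\<dots> = (2 * sin ((a - b) / 2))\<^sup>2"
  proof -
    have "a - b = 2 * ((a - b) / 2)" by simp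
    then have "cos (a - b) = 1 - 2 * (sin ((a - b) / 2))\<^sup>2" by (metis cos_double_sin)
    then show ?thesis by (simp add: power_mult_distrib)
  qed
  also have "\<dots> \<le> (a - b)\<^sup>2"
    using abs_sin_x_le_abs_x[of "(a - b) / 2"] by (intro abs_le_square_iff[THEN iffD1]) (simp add: abs_mult)
  finally show ?thesis by (metis abs_le_square_iff abs_norm_cancel)
qed

text \<open>Two operators that are diagonal in one orthonormal basis differ in norm by at most the
  largest difference of their diagonal entries.\<close>

lemma vnorm_conj_diagonal_diff_le:
  assumes R: "unitary n R" and v: "v \<in> carrier_vec n"
    and f: "\<And>i. i < n \<Longrightarrow> cmod (f i - g i) \<le> c" and c: "0 \<le> c"
  shows "vnorm (R * diagonal n f * adj R *\<^sub>v v - R * diagonal n g * adj R *\<^sub>v v) \<le> c * vnorm v"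
proof -
  note U = unitaryD[OF R]
  define w where "w = adj R *\<^sub>v v"
  have w: "w \<in> carrier_vec n" "vnorm w = vnorm v"
    using U v vnorm_unitary[OF unitary_adj[OF R] v] by (auto simp: w_def)
  have eq: "R * diagonal n h * adj R *\<^sub>v v = R *\<^sub>v (diagonal n h *\<^sub>v w)" for h
    using U v by (simp add: w_def assoc_mult_mat_vec[of _ n n _ n])
  have "R *\<^sub>v (diagonal n f *\<^sub>v w) - R *\<^sub>v (diagonal n g *\<^sub>v w) = R *\<^sub>v (diagonal n f *\<^sub>v w - diagonal n g *\<^sub>v w)"
    using U w by (intro mult_minus_distrib_mat_vec[symmetric, of _ n n]) (auto simp: diagonal_mult_vec)
  also have "diagonal n f *\<^sub>v w - diagonal n g *\<^sub>v w = diagonal n (\<lambda>i. f i - g i) *\<^sub>v w"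
    using w by (intro eq_vecI) (auto simp: diagonal_mult_vec algebra_simps)
  finally have "vnorm (R * diagonal n f * adj R *\<^sub>v v - R * diagonal n g * adj R *\<^sub>v v) = vnorm (diagonal n (\<lambda>i. f i - g i) *\<^sub>v w)"
    unfolding eq using w by (simp add: vnorm_unitary[OF R] diagonal_mult_vec)
  also have "\<dots> \<le> c * vnorm v" using vnorm_diagonal_le[OF w(1) f c] by (simp only: w(2))
  finally show ?thesis .
qed

lemma unitary_conj_phase:
  assumes "unitary n U"
  shows "unitary n (U * diagonal n (\<lambda>i. exp (\<i> * complex_of_real (f i))) * adj U)"
  by (intro unitary_mult unitary_adj assms unitary_diagonal) simp

text \<open>Subtracting the constants cA and cB from the two factors changes the Hamiltonian by local
  terms only, and the remaining nonlocal part has norm at most a * b.\<close>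

lemma mexp_near_local:
  assumes P: "unitary nA P" and Q: "unitary nB Q"
    and X: "\<And>i. i < nA \<Longrightarrow> \<bar>X i - cA\<bar> \<le> a" and Y: "\<And>j. j < nB \<Longrightarrow> \<bar>Y j - cB\<bar> \<le> b"
    and t: "0 \<le> t" and a: "0 \<le> a" and b: "0 \<le> b"
    and HL: "HL = kron (P * diagonal nA (\<lambda>i. complex_of_real (X i)) * adj P) (Q * diagonal nB (\<lambda>i. complex_of_real (Y i)) * adj Q)"
  shows "\<exists>LA LB. unitary nA LA \<and> unitary nB LB \<and>
     (\<forall>v\<in>carrier_vec (nA * nB).
        vnorm (mexp ((- \<i> * complex_of_real t) \<cdot>\<^sub>m HL) *\<^sub>v v - kron LA LB *\<^sub>v v) \<le> a * b * t * vnorm v)"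
proof -
  define R where "R = kron P Q"
  have R: "unitary (nA * nB) R" unfolding R_def by (rule unitary_kron[OF P Q])
  \<comment> \<open>The phases come from X Y - cB X - cA (Y - cB) = (X - cA) (Y - cB): what is
    linear in X goes to Alice, the rest to Bob, and the constant cA cB is absorbed on Bob's
    side.\<close>
  define LA where "LA = P * diagonal nA (\<lambda>i. exp (\<i> * complex_of_real (- t * cB * X i))) * adj P"
  define LB where "LB = Q * diagonal nB (\<lambda>j. exp (\<i> * complex_of_real (- t * cA * (Y j - cB)))) * adj Q"
  have L: "unitary nA LA" "unitary nB LB"
    unfolding LA_def LB_def by (intro unitary_conj_phase P Q)+
  have E: "mexp ((- \<i> * complex_of_real t) \<cdot>\<^sub>m HL)
      = R * diagonal (nA * nB) (\<lambda>i. exp (\<i> * complex_of_real (- t * X (i div nB) * Y (i mod nB)))) * adj R"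
    unfolding HL kron_conj_diagonal[OF P Q] R_def[symmetric] mexp_conj[OF R] by (simp add: mult.assoc)
  have L': "kron LA LB
      = R * diagonal (nA * nB) (\<lambda>i. exp (\<i> * complex_of_real (- t * cB * X (i div nB) - t * cA * (Y (i mod nB) - cB)))) * adj R"
    unfolding LA_def LB_def kron_conj_diagonal[OF P Q] R_def[symmetric] exp_add[symmetric]
    by (simp add: algebra_simps)
  have "vnorm (mexp ((- \<i> * complex_of_real t) \<cdot>\<^sub>m HL) *\<^sub>v v - kron LA LB *\<^sub>v v) \<le> (a * b * t) * vnorm v"
    if v: "v \<in> carrier_vec (nA * nB)" for v
    unfolding E L'
  proof (rule vnorm_conj_diagonal_diff_le[OF R v])
    fix i assume i: "i < nA * nB"
    let ?x = "X (i div nB)" and ?y = "Y (i mod nB)"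
    have "cmod (exp (\<i> * complex_of_real (- t * ?x * ?y)) - exp (\<i> * complex_of_real (- t * cB * ?x - t * cA * (?y - cB))))
        \<le> \<bar>(- t * ?x * ?y) - (- t * cB * ?x - t * cA * (?y - cB))\<bar>"
      by (rule cmod_exp_diff_le)
    also have "(- t * ?x * ?y) - (- t * cB * ?x - t * cA * (?y - cB)) = - t * ((?x - cA) * (?y - cB))"
      by (simp add: algebra_simps)
    also have "\<bar>\<dots>\<bar> = t * (\<bar>?x - cA\<bar> * \<bar>?y - cB\<bar>)" using t by (simp add: abs_mult)
    also have "\<dots> \<le> t * (a * b)"
      using X[OF div_less_of_mult[OF i]] Y[OF mod_less_of_mult[OF i]] t a b
      by (intro mult_left_mono mult_mono) auto
    finally show "cmod (exp (\<i> * complex_of_real (- t * ?x * ?y)) - exp (\<i> * complex_of_real (- t * cB * ?x - t * cA * (?y - cB))))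
       \<le> a * b * t" by (simp add: mult_ac)
  qed (use t a b in auto)
  with L show ?thesis by blast
qed

text \<open>A hybrid argument: the uses of H are replaced one by one by local unitaries. The
  surrounding factors are unitary, so the errors simply add and depend only on the total interaction
  time.\<close>

lemma run_steps_near_local:
  assumes P: "unitary nA P" and Q: "unitary nB Q"
    and X: "\<And>i. i < nA \<Longrightarrow> \<bar>X i - cA\<bar> \<le> a" and Y: "\<And>j. j < nB \<Longrightarrow> \<bar>Y j - cB\<bar> \<le> b"
    and a: "0 \<le> a" and b: "0 \<le> b"
    and HL: "HL = kron (P * diagonal nA (\<lambda>i. complex_of_real (X i)) * adj P) (Q * diagonal nB (\<lambda>i. complex_of_real (Y i)) * adj Q)"
  shows "(\<forall>(UA, UB, t) \<in> set steps. unitary nA UA \<and> unitary nB UB \<and> 0 \<le> t) \<Longrightarrow>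
     unitary (nA * nB) (run_steps (nA * nB) HL steps) \<and>
     (\<exists>LA LB. unitary nA LA \<and> unitary nB LB \<and>
       (\<forall>v\<in>carrier_vec (nA * nB).
        vnorm (run_steps (nA * nB) HL steps *\<^sub>v v - kron LA LB *\<^sub>v v) \<le> a * b * (\<Sum>(UA, UB, t) \<leftarrow> steps. t) * vnorm v))"
proof (induction steps)
  case Nil
  have "vnorm (1\<^sub>m (nA * nB) *\<^sub>v v - kron (1\<^sub>m nA) (1\<^sub>m nB) *\<^sub>v v) \<le> 0" if "v \<in> carrier_vec (nA * nB)" for v
    using that by (simp add: kron_one vnorm_def)
  then show ?case
    by (intro conjI exI[of _ "1\<^sub>m nA"] exI[of _ "1\<^sub>m nB"] ballI) simp_all
next
  case (Cons s steps)
  obtain UA UB t where s: "s = (UA, UB, t)" by (cases s) auto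
  have U: "unitary nA UA" "unitary nB UB" and t: "0 \<le> t" using Cons.prems s by auto
  let ?N = "nA * nB"
  define E where "E = mexp ((- \<i> * complex_of_real t) \<cdot>\<^sub>m HL)"
  define W where "W = run_steps ?N HL steps"
  define T where "T = (\<Sum>(UA, UB, t) \<leftarrow> steps. t)"
  obtain LA LB where L: "unitary nA LA" "unitary nB LB"
    and EL: "\<And>v. v \<in> carrier_vec ?N \<Longrightarrow> vnorm (E *\<^sub>v v - kron LA LB *\<^sub>v v) \<le> a * b * t * vnorm v"
    using mexp_near_local[OF P Q X Y t a b HL] unfolding E_def by blast
  obtain MA MB where M: "unitary nA MA" "unitary nB MB" and uW: "unitary ?N W"
    and WM: "\<And>v. v \<in> carrier_vec ?N \<Longrightarrow> vnorm (W *\<^sub>v v - kron MA MB *\<^sub>v v) \<le> a * b * T * vnorm v"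
    using Cons.IH Cons.prems unfolding W_def T_def by auto
  have uE: "unitary ?N E"
  proof -
    have "E = kron P Q * diagonal ?N (\<lambda>i. exp (\<i> * complex_of_real (- t * X (i div nB) * Y (i mod nB)))) * adj (kron P Q)"
      unfolding E_def HL kron_conj_diagonal[OF P Q] mexp_conj[OF unitary_kron[OF P Q]] by (simp add: mult.assoc)
    then show ?thesis using unitary_conj_phase[OF unitary_kron[OF P Q]] by (simp only:)
  qed
  note uU = unitary_kron[OF U] and uL = unitary_kron[OF L] and uM = unitary_kron[OF M]
  have run: "run_steps ?N HL (s # steps) = W * (E * kron UA UB)"
    by (simp add: s W_def E_def)
  have "unitary ?N (run_steps ?N HL (s # steps))"
    unfolding run by (intro unitary_mult uW uE uU)
  moreover have "vnorm (run_steps ?N HL (s # steps) *\<^sub>v v - kron (MA * (LA * UA)) (MB * (LB * UB)) *\<^sub>v v)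
      \<le> a * b * (\<Sum>(UA, UB, t) \<leftarrow> s # steps. t) * vnorm v" if v: "v \<in> carrier_vec ?N" for v
  proof -
    note c = unitaryD(1)[OF uU] unitaryD(1)[OF uL] unitaryD(1)[OF uM] unitaryD(1)[OF uW] unitaryD(1)[OF uE]
      unitaryD(1)[OF U(1)] unitaryD(1)[OF U(2)] unitaryD(1)[OF L(1)] unitaryD(1)[OF L(2)]
      unitaryD(1)[OF M(1)] unitaryD(1)[OF M(2)]
    define w where "w = kron UA UB *\<^sub>v v"
    have w: "w \<in> carrier_vec ?N" "vnorm w = vnorm v"
      using vnorm_unitary[OF uU v] c v by (auto simp: w_def)
    have Ew: "E *\<^sub>v w \<in> carrier_vec ?N" "vnorm (E *\<^sub>v w) = vnorm v"
      using vnorm_unitary[OF uE w(1)] c w by auto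
    have Lw: "kron LA LB *\<^sub>v w \<in> carrier_vec ?N" using c w by auto
    have 1: "run_steps ?N HL (s # steps) *\<^sub>v v = W *\<^sub>v (E *\<^sub>v w)"
      unfolding run using c v by (simp add: w_def assoc_mult_mat_vec[of _ ?N ?N _ ?N])
    have 2: "kron (MA * (LA * UA)) (MB * (LB * UB)) *\<^sub>v v = kron MA MB *\<^sub>v (kron LA LB *\<^sub>v w)"
    proof -
      have "kron (MA * (LA * UA)) (MB * (LB * UB)) = kron MA MB * (kron LA LB * kron UA UB)"
        using c by (simp add: kron_mult[of _ nA nA _ nB nB _ nA _ nB])
      then show ?thesis using c v by (simp add: w_def assoc_mult_mat_vec[of _ ?N ?N _ ?N])
    qed
    \<comment> \<open>Intermediate hybrid: the current use of H is exact, while all later steps are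
      already replaced by \<open>kron MA MB\<close>.\<close>
    have "vnorm (W *\<^sub>v (E *\<^sub>v w) - kron MA MB *\<^sub>v (kron LA LB *\<^sub>v w))
       \<le> vnorm (W *\<^sub>v (E *\<^sub>v w) - kron MA MB *\<^sub>v (E *\<^sub>v w))
         + vnorm (kron MA MB *\<^sub>v (E *\<^sub>v w) - kron MA MB *\<^sub>v (kron LA LB *\<^sub>v w))"
      using c Ew Lw by (intro vnorm_triangle_diff[of _ ?N]) auto
    also have "kron MA MB *\<^sub>v (E *\<^sub>v w) - kron MA MB *\<^sub>v (kron LA LB *\<^sub>v w)
        = kron MA MB *\<^sub>v (E *\<^sub>v w - kron LA LB *\<^sub>v w)"
      using c Ew Lw by (intro mult_minus_distrib_mat_vec[symmetric, of _ ?N ?N]) auto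
    also have "vnorm \<dots> = vnorm (E *\<^sub>v w - kron LA LB *\<^sub>v w)"
      using Ew Lw by (intro vnorm_unitary[OF uM]) auto
    also have "vnorm (W *\<^sub>v (E *\<^sub>v w) - kron MA MB *\<^sub>v (E *\<^sub>v w)) + \<dots> \<le> a * b * T * vnorm v + a * b * t * vnorm v"
      using WM[OF Ew(1)] EL[OF w(1)] Ew w by simp
    finally show ?thesis unfolding 1 2 by (simp add: s T_def algebra_simps)
  qed
  moreover have "unitary nA (MA * (LA * UA))" "unitary nB (MB * (LB * UB))"
    by (intro unitary_mult U L M)+
  ultimately show ?case by blast
qed

section \<open>Overlaps with product vectors\<close>

lemma kronv_dim [simp]: "dim_vec (kronv u v) = dim_vec u * dim_vec v"
  by (simp add: kronv_def)

text \<open>Let u be the projection of v onto the span of f and g. Then |u|^2 and <u, v> both equal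
  |a|^2 + |b|^2, and the claim is 0 \<le> |u - v|^2.\<close>

lemma bessel_two:
  assumes c: "f \<in> carrier_vec d" "g \<in> carrier_vec d" "v \<in> carrier_vec d"
    and orth: "cinner f f = 1" "cinner g g = 1" "cinner f g = 0"
  shows "(cmod (cinner f v))\<^sup>2 + (cmod (cinner g v))\<^sup>2 \<le> (vnorm v)\<^sup>2"
proof -
  define a b where "a = cinner f v" and "b = cinner g v"
  define u where "u = (\<lambda>i. a * f $ i + b * g $ i)"
  have gf: "cinner g f = 0"
    using arg_cong[OF orth(3), of cnj] c by (simp add: cinner_def mult.commute)
  have uu: "(\<Sum>i<d. cnj (u i) * u i) = cnj a * a + cnj b * b"
  proof -
    have "(\<Sum>i<d. cnj (u i) * u i) = (\<Sum>i<d. cnj a * a * (cnj (f $ i) * f $ i) + cnj a * b * (cnj (f $ i) * g $ i)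
        + cnj b * a * (cnj (g $ i) * f $ i) + cnj b * b * (cnj (g $ i) * g $ i))"
      by (rule sum.cong) (simp_all add: u_def algebra_simps)
    also have "\<dots> = cnj a * a * cinner f f + cnj a * b * cinner f g + cnj b * a * cinner g f + cnj b * b * cinner g g"
      unfolding cinner_def carrier_vecD[OF c(1)] carrier_vecD[OF c(2)] by (simp only: sum.distrib sum_distrib_left)
    finally show ?thesis by (simp add: orth gf)
  qed
  have vu: "(\<Sum>i<d. cnj (u i) * v $ i) = cnj a * a + cnj b * b"
  proof -
    have "(\<Sum>i<d. cnj (u i) * v $ i) = (\<Sum>i<d. cnj a * (cnj (f $ i) * v $ i) + cnj b * (cnj (g $ i) * v $ i))"
      by (rule sum.cong) (simp_all add: u_def algebra_simps)
    also have "\<dots> = cnj a * cinner f v + cnj b * cinner g v"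
      unfolding cinner_def carrier_vecD[OF c(3)] by (simp only: sum.distrib sum_distrib_left)
    finally show ?thesis by (simp add: a_def b_def)
  qed
  have aa: "cnj a * a + cnj b * b = complex_of_real ((cmod a)\<^sup>2 + (cmod b)\<^sup>2)"
    unfolding of_real_add complex_norm_square by (simp add: mult.commute)
  have "(\<Sum>i<d. (cmod (u i))\<^sup>2) = (cmod a)\<^sup>2 + (cmod b)\<^sup>2"
  proof -
    have "complex_of_real (\<Sum>i<d. (cmod (u i))\<^sup>2) = (\<Sum>i<d. cnj (u i) * u i)"
      unfolding of_real_sum complex_norm_square by (simp add: mult.commute)
    then show ?thesis unfolding uu aa of_real_eq_iff .
  qed
  moreover have "(\<Sum>i<d. Re (cnj (u i) * v $ i)) = (cmod a)\<^sup>2 + (cmod b)\<^sup>2"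
    unfolding Re_sum[symmetric] vu aa by simp
  moreover have "0 \<le> (\<Sum>i<d. (cmod (u i - v $ i))\<^sup>2)" by (simp add: sum_nonneg)
  then have "0 \<le> (\<Sum>i<d. (cmod (u i))\<^sup>2) + (\<Sum>i<d. (cmod (v $ i))\<^sup>2) - 2 * (\<Sum>i<d. Re (cnj (u i) * v $ i))"
    unfolding cmod_diff_power2 sum.distrib sum_subtractf sum_distrib_left .
  ultimately show ?thesis by (simp add: vnorm_power2[OF c(3)] a_def b_def)
qed

lemma cinner_cnj: "dim_vec u = dim_vec v \<Longrightarrow> cinner u v = cnj (cinner v u)"
  by (simp add: cinner_def mult.commute)

text \<open>A regrouping of four tensor factors: each party's ancilla stands next to that party's
  part of the target, so a product input is a product across the Alice-Bob cut.\<close>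

lemma embed_in_kronv:
  assumes "p \<in> carrier_vec dA" "q \<in> carrier_vec dB" "alpha \<in> carrier_vec a" "beta \<in> carrier_vec b"
  shows "embed_in dA dB a b (kronv p q) alpha beta = kronv (kronv p alpha) (kronv q beta)"
proof (rule eq_vecI)
  fix i assume "i < dim_vec (kronv (kronv p alpha) (kronv q beta))"
  then have i: "i < dA * a * (dB * b)" using assms by (auto simp: kronv_def)
  note A = div_less_of_mult[OF i] and B = mod_less_of_mult[OF i]
  note less = div_less_of_mult[OF A] div_less_of_mult[OF B]
  show "embed_in dA dB a b (kronv p q) alpha beta $ i = kronv (kronv p alpha) (kronv q beta) $ i"
    using i A B less kronv_index[OF assms(1,2) index_less_mult[OF less]]
      kronv_index[OF kronv_carrier[OF assms(1,3)] kronv_carrier[OF assms(2,4)] i]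
      kronv_index[OF assms(1,3) A] kronv_index[OF assms(2,4) B]
    by (simp add: embed_in_def Let_def)
qed (use assms in \<open>auto simp: embed_in_def kronv_def\<close>)

lemma embed_in_carrier [simp]: "embed_in dA dB a b psi alpha beta \<in> carrier_vec (dA * a * (dB * b))"
  and embed_out_carrier [simp]: "embed_out dA dB a b chi phi \<in> carrier_vec (dA * a * (dB * b))"
  by (auto simp: embed_in_def embed_out_def)

lemma embed_out_index:
  assumes "i < dA" "x < a" "j < dB" "z < b"
  shows "embed_out dA dB a b chi phi $ ((i * a + x) * (dB * b) + (j * b + z)) = chi $ (i * dB + j) * phi $ (x * b + z)"
  using assms index_less_mult[OF index_less_mult[OF assms(1,2)] index_less_mult[OF assms(3,4)]] index_less_mult[OF assms(3,4)]
  by (simp add: embed_out_def Let_def)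

text \<open>The ancilla digits x, z are put outside, so that fixing them leaves a sum over the
  target system alone.\<close>

lemma sum_lab:
  fixes F :: "nat \<Rightarrow> 'a::comm_monoid_add"
  shows "(\<Sum>k<dA * a * (dB * b). F k)
    = (\<Sum>x<a. \<Sum>z<b. \<Sum>i<dA. \<Sum>j<dB. F ((i * a + x) * (dB * b) + (j * b + z)))"
proof -
  have "(\<Sum>k<dA * a * (dB * b). F k) = (\<Sum>i<dA. \<Sum>x<a. \<Sum>j<dB. \<Sum>z<b. F ((i * a + x) * (dB * b) + (j * b + z)))"
    unfolding sum_mult_split ..
  also have "\<dots> = (\<Sum>x<a. \<Sum>i<dA. \<Sum>j<dB. \<Sum>z<b. F ((i * a + x) * (dB * b) + (j * b + z)))"
    by (rule sum.swap)
  also have "\<dots> = (\<Sum>x<a. \<Sum>i<dA. \<Sum>z<b. \<Sum>j<dB. F ((i * a + x) * (dB * b) + (j * b + z)))"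
    by (intro sum.cong refl sum.swap)
  also have "\<dots> = (\<Sum>x<a. \<Sum>z<b. \<Sum>i<dA. \<Sum>j<dB. F ((i * a + x) * (dB * b) + (j * b + z)))"
    by (intro sum.cong refl sum.swap)
  finally show ?thesis .
qed

lemma vnorm_embed_out:
  assumes "chi \<in> carrier_vec (dA * dB)" "phi \<in> carrier_vec (a * b)"
  shows "vnorm (embed_out dA dB a b chi phi) = vnorm chi * vnorm phi"
proof -
  have "(vnorm (embed_out dA dB a b chi phi))\<^sup>2
      = (\<Sum>x<a. \<Sum>z<b. \<Sum>i<dA. \<Sum>j<dB. (cmod (chi $ (i * dB + j)))\<^sup>2 * (cmod (phi $ (x * b + z)))\<^sup>2)"
    unfolding vnorm_power2[OF embed_out_carrier] sum_lab
    by (intro sum.cong refl) (simp add: embed_out_index norm_mult power_mult_distrib)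
  also have "\<dots> = (\<Sum>x<a. \<Sum>z<b. (\<Sum>i<dA. \<Sum>j<dB. (cmod (chi $ (i * dB + j)))\<^sup>2) * (cmod (phi $ (x * b + z)))\<^sup>2)"
    by (simp add: sum_distrib_right)
  also have "\<dots> = (vnorm chi)\<^sup>2 * (vnorm phi)\<^sup>2"
    unfolding vnorm_power2[OF assms(1)] vnorm_power2[OF assms(2)] sum_mult_split
    by (simp add: sum_distrib_left)
  also have "\<dots> = (vnorm chi * vnorm phi)\<^sup>2" by (simp add: power_mult_distrib)
  finally show ?thesis by (simp add: power2_eq_iff_nonneg)
qed

lemma vnorm_slices:
  assumes "p \<in> carrier_vec (d * a)"
  shows "(\<Sum>x<a. (vnorm (vec d (\<lambda>i. p $ (i * a + x))))\<^sup>2) = (vnorm p)\<^sup>2"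
  unfolding vnorm_power2[OF assms] sum_mult_split
  by (subst sum.swap) (simp add: vnorm_power2[of _ d])

text \<open>Combines the two Bessel inequalities, one per party, in the overlap estimate.\<close>

lemma two_dim_cauchy_schwarz:
  fixes p q r s :: real
  assumes "p\<^sup>2 + q\<^sup>2 \<le> m\<^sup>2" "r\<^sup>2 + s\<^sup>2 \<le> n\<^sup>2" "0 \<le> m" "0 \<le> n"
  shows "p * r + q * s \<le> m * n"
proof -
  have "(p * r + q * s)\<^sup>2 \<le> (p\<^sup>2 + q\<^sup>2) * (r\<^sup>2 + s\<^sup>2)"
    using zero_le_power2[of "p * s - q * r"] by (simp add: power2_eq_square algebra_simps)
  also have "\<dots> \<le> m\<^sup>2 * n\<^sup>2" using assms by (intro mult_mono) auto
  finally have "(p * r + q * s)\<^sup>2 \<le> (m * n)\<^sup>2" by (simp add: power_mult_distrib)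
  then show ?thesis using assms by (meson mult_nonneg_nonneg power2_le_imp_le)
qed

text \<open>The discarded ancilla state phi may be entangled; this does not help, because the maximal
  overlap with product vectors is governed by the largest Schmidt coefficient, which is
  multiplicative.\<close>

lemma product_overlap_le:
  assumes pA: "pA \<in> carrier_vec (dA * a)" "vnorm pA = 1" and pB: "pB \<in> carrier_vec (dB * b)" "vnorm pB = 1"
    and phi: "phi \<in> carrier_vec (a * b)" "vnorm phi = 1"
    and f: "f0 \<in> carrier_vec dA" "f1 \<in> carrier_vec dA" "cinner f0 f0 = 1" "cinner f1 f1 = 1" "cinner f0 f1 = 0"
    and g: "g0 \<in> carrier_vec dB" "g1 \<in> carrier_vec dB" "cinner g0 g0 = 1" "cinner g1 g1 = 1" "cinner g0 g1 = 0"
    and m: "cmod c \<le> m" "cmod s \<le> m"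
  shows "cmod (cinner (kronv pA pB) (embed_out dA dB a b (c \<cdot>\<^sub>v kronv f0 g0 + s \<cdot>\<^sub>v kronv f1 g1) phi)) \<le> m"
proof -
  let ?chi = "c \<cdot>\<^sub>v kronv f0 g0 + s \<cdot>\<^sub>v kronv f1 g1"
  \<comment> \<open>Partial inner products of the product vector with the ancilla basis vectors x
    and z; they are unnormalised vectors of the target parts.\<close>
  define sA where "sA x = vec dA (\<lambda>i. pA $ (i * a + x))" for x
  define sB where "sB z = vec dB (\<lambda>j. pB $ (j * b + z))" for z
  have sc: "sA x \<in> carrier_vec dA" "sB z \<in> carrier_vec dB" for x z by (auto simp: sA_def sB_def)
  have m0: "0 \<le> m" using m(1) norm_ge_zero[of c] by linarith
  have chi: "?chi $ (i * dB + j) = c * (f0 $ i * g0 $ j) + s * (f1 $ i * g1 $ j)" if "i < dA" "j < dB" for i j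
    using that f g index_less_mult[OF that]
    by (auto simp: kronv_index[of _ dA _ dB])
  have pp: "kronv pA pB $ ((i * a + x) * (dB * b) + (j * b + z)) = pA $ (i * a + x) * pB $ (j * b + z)"
    if "i < dA" "x < a" "j < dB" "z < b" for i x j z
  proof -
    note l = index_less_mult[OF that(3,4)]
    have "((i * a + x) * (dB * b) + (j * b + z)) div (dB * b) = i * a + x"
      using l that by (subst div_mult_self3) auto
    then show ?thesis
      using kronv_index[OF pA(1) pB(1) index_less_mult[OF index_less_mult[OF that(1,2)] l]] l by simp
  qed
  have "cinner (kronv pA pB) (embed_out dA dB a b ?chi phi)
     = (\<Sum>x<a. \<Sum>z<b. \<Sum>i<dA. \<Sum>j<dB. cnj (pA $ (i * a + x) * pB $ (j * b + z)) *
          ((c * (f0 $ i * g0 $ j) + s * (f1 $ i * g1 $ j)) * phi $ (x * b + z)))"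
    unfolding cinner_def carrier_vecD[OF embed_out_carrier] sum_lab
    by (intro sum.cong refl) (simp add: embed_out_index pp chi)
  also have "\<dots> = (\<Sum>x<a. \<Sum>z<b. phi $ (x * b + z) *
       (c * (cinner (sA x) f0 * cinner (sB z) g0) + s * (cinner (sA x) f1 * cinner (sB z) g1)))"
  proof (intro sum.cong refl)
    fix x z
    have ip: "cinner (sA x) f0 = (\<Sum>i<dA. cnj (pA $ (i * a + x)) * f0 $ i)" "cinner (sA x) f1 = (\<Sum>i<dA. cnj (pA $ (i * a + x)) * f1 $ i)"
      "cinner (sB z) g0 = (\<Sum>j<dB. cnj (pB $ (j * b + z)) * g0 $ j)" "cinner (sB z) g1 = (\<Sum>j<dB. cnj (pB $ (j * b + z)) * g1 $ j)"
      using f g by (auto simp: cinner_def sA_def sB_def intro!: sum.cong)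
    show "(\<Sum>i<dA. \<Sum>j<dB. cnj (pA $ (i * a + x) * pB $ (j * b + z)) *
          ((c * (f0 $ i * g0 $ j) + s * (f1 $ i * g1 $ j)) * phi $ (x * b + z)))
      = phi $ (x * b + z) * (c * (cinner (sA x) f0 * cinner (sB z) g0) + s * (cinner (sA x) f1 * cinner (sB z) g1))"
      unfolding ip sum_product unfolding sum_distrib_left unfolding sum.distrib[symmetric]
      unfolding sum_distrib_left
      by (intro sum.cong refl) (simp add: algebra_simps)
  qed
  finally have eq: "cinner (kronv pA pB) (embed_out dA dB a b ?chi phi) = \<dots>" .
  \<comment> \<open>For fixed ancilla digits: Bessel for each party's slice, then Cauchy-Schwarz
    over the two Schmidt terms, with m bounding both coefficients.\<close>
  have bound: "cmod (phi $ k * (c * (cinner (sA x) f0 * cinner (sB z) g0) + s * (cinner (sA x) f1 * cinner (sB z) g1)))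
     \<le> m * (cmod (phi $ k) * (vnorm (sA x) * vnorm (sB z)))" for k x z
  proof -
    have A: "(cmod (cinner (sA x) f0))\<^sup>2 + (cmod (cinner (sA x) f1))\<^sup>2 \<le> (vnorm (sA x))\<^sup>2"
      using bessel_two[OF f(1,2) sc(1) f(3-5)] f sc(1)[of x]
      by (simp add: cinner_cnj[of "sA x"])
    have B: "(cmod (cinner (sB z) g0))\<^sup>2 + (cmod (cinner (sB z) g1))\<^sup>2 \<le> (vnorm (sB z))\<^sup>2"
      using bessel_two[OF g(1,2) sc(2) g(3-5)] g sc(2)[of z]
      by (simp add: cinner_cnj[of "sB z"])
    have "cmod (c * (cinner (sA x) f0 * cinner (sB z) g0) + s * (cinner (sA x) f1 * cinner (sB z) g1))
       \<le> cmod c * (cmod (cinner (sA x) f0) * cmod (cinner (sB z) g0)) + cmod s * (cmod (cinner (sA x) f1) * cmod (cinner (sB z) g1))"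
      by (metis norm_mult norm_triangle_ineq)
    also have "\<dots> \<le> m * (cmod (cinner (sA x) f0) * cmod (cinner (sB z) g0)) + m * (cmod (cinner (sA x) f1) * cmod (cinner (sB z) g1))"
      using m by (intro add_mono mult_right_mono) auto
    also have "\<dots> \<le> m * (vnorm (sA x) * vnorm (sB z))"
      unfolding distrib_left[symmetric]
      by (intro mult_left_mono m0 two_dim_cauchy_schwarz A B) auto
    finally show ?thesis unfolding norm_mult[of "phi $ k"]
      by (metis mult.left_commute mult_left_mono norm_ge_zero)
  qed
  have "cmod (cinner (kronv pA pB) (embed_out dA dB a b ?chi phi))
     \<le> (\<Sum>x<a. \<Sum>z<b. m * (cmod (phi $ (x * b + z)) * (vnorm (sA x) * vnorm (sB z))))"
    unfolding eq by (intro order_trans[OF norm_sum] sum_mono bound)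
  also have "\<dots> = m * (\<Sum>k<a * b. \<bar>cmod (phi $ k)\<bar> * \<bar>vnorm (sA (k div b)) * vnorm (sB (k mod b))\<bar>)"
    unfolding sum_mult_split sum_distrib_left by (intro sum.cong refl) simp
  \<comment> \<open>Cauchy-Schwarz over the joint ancilla index decouples \<open>phi\<close> from
    the slices; both resulting norms are 1, whether or not \<open>phi\<close> is entangled.\<close>
  also have "\<dots> \<le> m * (L2_set (\<lambda>k. cmod (phi $ k)) {..<a * b} * L2_set (\<lambda>k. vnorm (sA (k div b)) * vnorm (sB (k mod b))) {..<a * b})"
    by (intro mult_left_mono L2_set_mult_ineq m0)
  also have "L2_set (\<lambda>k. cmod (phi $ k)) {..<a * b} = 1"
    using vnorm_L2_set[OF phi(1)] phi(2) by simp
  also have "L2_set (\<lambda>k. vnorm (sA (k div b)) * vnorm (sB (k mod b))) {..<a * b} = 1"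
  proof -
    have "(\<Sum>k<a * b. (vnorm (sA (k div b)) * vnorm (sB (k mod b)))\<^sup>2) = (\<Sum>x<a. (vnorm (sA x))\<^sup>2) * (\<Sum>z<b. (vnorm (sB z))\<^sup>2)"
      unfolding sum_mult_split sum_product by (intro sum.cong refl) (simp add: power_mult_distrib)
    also have "\<dots> = 1" unfolding sA_def sB_def by (simp add: vnorm_slices[OF pA(1)] vnorm_slices[OF pB(1)] pA pB)
    finally show ?thesis by (simp add: L2_set_def)
  qed
  finally show ?thesis by simp
qed

section \<open>Schmidt form of the target evolution and the lower bound on the time\<close>

definition two_vec :: "nat \<Rightarrow> nat \<Rightarrow> nat \<Rightarrow> complex \<Rightarrow> complex \<Rightarrow> complex vec" where
  "two_vec d k l a b = vec d (\<lambda>i. if i = k then a else if i = l then b else 0)"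

lemma two_vec_carrier [simp]: "two_vec d k l a b \<in> carrier_vec d"
  by (simp add: two_vec_def)

lemma two_vec_index: "i < d \<Longrightarrow> two_vec d k l a b $ i = (if i = k then a else if i = l then b else 0)"
  by (simp add: two_vec_def)

lemma cinner_two_vec:
  assumes "k < d" "l < d" "k \<noteq> l"
  shows "cinner (two_vec d k l a b) (two_vec d k l a' b') = cnj a * a' + cnj b * b'"
proof -
  have "cinner (two_vec d k l a b) (two_vec d k l a' b')
     = (\<Sum>i<d. (if i = k then cnj a * a' else 0) + (if i = l then cnj b * b' else 0))"
    unfolding cinner_def using assms by (intro sum.cong) (auto simp: two_vec_def)
  also have "\<dots> = cnj a * a' + cnj b * b'"
    using assms by (simp add: sum.distrib)
  finally show ?thesis .
qed

text \<open>On the extremal eigenvectors the factors act as cA + a Z and cB + b Z. Apart from local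
  phases the evolution is exp(-i t a b Z \<otimes> Z) = cos(t a b) - i sin(t a b) Z \<otimes> Z, and
  Z maps the equal superposition to an orthogonal one; hence two Schmidt terms.\<close>

lemma product_evolution_schmidt:
  assumes U: "unitary dA U" and V: "unitary dB V"
    and kl: "k < dA" "l < dA" "k \<noteq> l" "x k = cA + a" "x l = cA - a"
    and mn: "m < dB" "n < dB" "m \<noteq> n" "y m = cB + b" "y n = cB - b"
    and H: "H = kron (U * diagonal dA (\<lambda>i. complex_of_real (x i)) * adj U) (V * diagonal dB (\<lambda>i. complex_of_real (y i)) * adj V)"
  shows "\<exists>p q f0 f1 g0 g1. p \<in> carrier_vec dA \<and> vnorm p = 1 \<and> q \<in> carrier_vec dB \<and> vnorm q = 1
    \<and> f0 \<in> carrier_vec dA \<and> f1 \<in> carrier_vec dA \<and> cinner f0 f0 = 1 \<and> cinner f1 f1 = 1 \<and> cinner f0 f1 = 0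
    \<and> g0 \<in> carrier_vec dB \<and> g1 \<in> carrier_vec dB \<and> cinner g0 g0 = 1 \<and> cinner g1 g1 = 1 \<and> cinner g0 g1 = 0
    \<and> mexp ((- \<i> * complex_of_real t) \<cdot>\<^sub>m H) *\<^sub>v kronv p q
      = complex_of_real (cos (t * (a * b))) \<cdot>\<^sub>v kronv f0 g0 + (- \<i> * complex_of_real (sin (t * (a * b)))) \<cdot>\<^sub>v kronv f1 g1"
proof -
  define r where "r = complex_of_real (1 / sqrt 2)"
  have rr: "cnj r * r = 1 / 2" "r * r = 1 / 2" "cnj r = r"
    by (simp_all add: r_def flip: of_real_mult)
  have unit: "cnj (r * cis \<theta>) * (r * cis \<theta>) = 1 / 2" for \<theta>
  proof -
    have "cnj (r * cis \<theta>) * (r * cis \<theta>) = (cnj r * r) * (cnj (cis \<theta>) * cis \<theta>)" by (simp add: mult_ac)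
    then show ?thesis by (simp add: rr cis_cnj cis_mult)
  qed
  define R where "R = kron U V"
  have R: "unitary (dA * dB) R" unfolding R_def by (rule unitary_kron[OF U V])
  note UD = unitaryD[OF U] and VD = unitaryD[OF V] and RD = unitaryD[OF R]
  define e where "e = two_vec dA k l r r"
  define e' where "e' = two_vec dB m n r r"
  \<comment> \<open>The centring phases: with signs s, r = \<plusminus>1, Alice takes the term s a
    cB and Bob the term cA (cB + r b), so that only s r a b is left over. They are built into the
    Schmidt vectors.\<close>
  define uk where "uk = r * cis (- t * cB * a)"
  define ul where "ul = r * cis (t * cB * a)"
  define vm where "vm = r * cis (- t * cA * (cB + b))"
  define vn where "vn = r * cis (- t * cA * (cB - b))"
  note ph = unit[of "- t * cB * a", folded uk_def] unit[of "t * cB * a", folded ul_def]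
    unit[of "- t * cA * (cB + b)", folded vm_def] unit[of "- t * cA * (cB - b)", folded vn_def]
  define f0 f1 where "f0 = two_vec dA k l uk ul" and "f1 = two_vec dA k l uk (- ul)"
  define g0 g1 where "g0 = two_vec dB m n vm vn" and "g1 = two_vec dB m n vm (- vn)"
  have car: "e \<in> carrier_vec dA" "e' \<in> carrier_vec dB" "f0 \<in> carrier_vec dA" "f1 \<in> carrier_vec dA"
    "g0 \<in> carrier_vec dB" "g1 \<in> carrier_vec dB"
    by (auto simp: e_def e'_def f0_def f1_def g0_def g1_def)
  have norm1: "vnorm w = 1" if "cinner w w = 1" for w
    using that unfolding cinner_self of_real_eq_1_iff by (simp add: power2_eq_1_iff) (use vnorm_nonneg[of w] in linarith)
  have ips: "cinner e e = 1" "cinner e' e' = 1" "cinner f0 f0 = 1" "cinner f1 f1 = 1" "cinner f0 f1 = 0"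
    "cinner g0 g0 = 1" "cinner g1 g1 = 1" "cinner g0 g1 = 0"
    unfolding e_def e'_def f0_def f1_def g0_def g1_def cinner_two_vec[OF kl(1-3)] cinner_two_vec[OF mn(1-3)]
    by (simp_all add: ph rr(1))
  define C where "C = complex_of_real (cos (t * (a * b)))"
  define S where "S = - \<i> * complex_of_real (sin (t * (a * b)))"
  define h where "h i = exp (- \<i> * complex_of_real t * (complex_of_real (x (i div dB)) * complex_of_real (y (i mod dB))))" for i
  have h: "h i = cis (- t * (x (i div dB) * y (i mod dB)))" for i
    by (simp add: h_def cis_conv_exp mult_ac)
  have cs: "cis (- (t * (a * b))) = C + S" "cis (t * (a * b)) = C - S"
    by (simp_all add: C_def S_def complex_eq_iff)
  \<comment> \<open>One identity for each pair of signs: equal signs leave the phase C + S, opposite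
    signs C - S.\<close>
  have "cis (- t * ((cA + a) * (cB + b))) * (r * r) = uk * vm * (C + S)"
    "cis (- t * ((cA + a) * (cB - b))) * (r * r) = uk * vn * (C - S)"
    "cis (- t * ((cA - a) * (cB + b))) * (r * r) = ul * vm * (C - S)"
    "cis (- t * ((cA - a) * (cB - b))) * (r * r) = ul * vn * (C + S)"
    unfolding cs[symmetric] uk_def ul_def vm_def vn_def by (simp_all add: cis_mult algebra_simps)
  then have pts: "cis (- t * ((cA + a) * (cB + b))) * (r * r) = C * (uk * vm) + S * (uk * vm)"
    "cis (- t * ((cA + a) * (cB - b))) * (r * r) = C * (uk * vn) + S * (uk * (- vn))"
    "cis (- t * ((cA - a) * (cB + b))) * (r * r) = C * (ul * vm) + S * ((- ul) * vm)"
    "cis (- t * ((cA - a) * (cB - b))) * (r * r) = C * (ul * vn) + S * ((- ul) * (- vn))"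
    by (simp_all only:) (simp_all add: algebra_simps)
  have evo: "diagonal (dA * dB) h *\<^sub>v kronv e e' = C \<cdot>\<^sub>v kronv f0 g0 + S \<cdot>\<^sub>v kronv f1 g1"
  proof (rule eq_vecI)
    fix i assume "i < dim_vec (C \<cdot>\<^sub>v kronv f0 g0 + S \<cdot>\<^sub>v kronv f1 g1)"
    then have i: "i < dA * dB" using car by auto
    note il = div_less_of_mult[OF i] mod_less_of_mult[OF i]
    have L: "(diagonal (dA * dB) h *\<^sub>v kronv e e') $ i = h i * (e $ (i div dB) * e' $ (i mod dB))"
      using i car kronv_index[OF car(1,2) i] by (subst diagonal_mult_vec) auto
    have "(C \<cdot>\<^sub>v kronv f0 g0 + S \<cdot>\<^sub>v kronv f1 g1) $ i
       = C * (f0 $ (i div dB) * g0 $ (i mod dB)) + S * (f1 $ (i div dB) * g1 $ (i mod dB))"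
      using i car kronv_index[OF car(3,5) i] kronv_index[OF car(4,6) i] by auto
    also have "\<dots> = h i * (e $ (i div dB) * e' $ (i mod dB))"
    proof -
      let ?i = "i div dB" and ?j = "i mod dB"
      have lk: "l \<noteq> k" "n \<noteq> m" using kl mn by auto
      note vecs = e_def e'_def f0_def f1_def g0_def g1_def two_vec_index[OF il(1)] two_vec_index[OF il(2)]
      consider "?i = k" "?j = m" | "?i = k" "?j = n" | "?i = l" "?j = m" | "?i = l" "?j = n"
        | "?i \<noteq> k" "?i \<noteq> l" | "?j \<noteq> m" "?j \<noteq> n" by blast
      then show ?thesis
      proof cases
        case 1
        show ?thesis unfolding h vecs unfolding 1 kl(4) mn(4) by (simp only: simp_thms if_True pts)
      next
        case 2
        show ?thesis unfolding h vecs unfolding 2 kl(4) mn(5) by (simp only: simp_thms if_True if_False lk pts)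
      next
        case 3
        show ?thesis unfolding h vecs unfolding 3 kl(5) mn(4) by (simp only: simp_thms if_True if_False lk pts)
      next
        case 4
        show ?thesis unfolding h vecs unfolding 4 kl(5) mn(5) by (simp only: simp_thms if_True if_False lk pts)
      qed (simp_all add: vecs)
    qed
    finally show "(diagonal (dA * dB) h *\<^sub>v kronv e e') $ i = (C \<cdot>\<^sub>v kronv f0 g0 + S \<cdot>\<^sub>v kronv f1 g1) $ i"
      using L by simp
  qed (use car in auto)
  have "mexp ((- \<i> * complex_of_real t) \<cdot>\<^sub>m H) = R * diagonal (dA * dB) h * adj R"
    unfolding H kron_conj_diagonal[OF U V] R_def[symmetric] mexp_conj[OF R] h_def ..
  moreover have "kronv (U *\<^sub>v e) (V *\<^sub>v e') = R *\<^sub>v kronv e e'"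
    unfolding R_def by (rule kron_mult_kronv[OF UD(1) VD(1) car(1,2), symmetric])
  moreover have "(R * diagonal (dA * dB) h * adj R) *\<^sub>v (R *\<^sub>v kronv e e') = R *\<^sub>v (diagonal (dA * dB) h *\<^sub>v kronv e e')"
  proof -
    have ee: "kronv e e' \<in> carrier_vec (dA * dB)" using car by simp
    have "adj R *\<^sub>v (R *\<^sub>v kronv e e') = kronv e e'"
      using RD ee by (simp flip: assoc_mult_mat_vec[of _ "dA * dB" "dA * dB" _ "dA * dB"])
    then show ?thesis using RD ee by (simp add: assoc_mult_mat_vec[of _ "dA * dB" "dA * dB" _ "dA * dB"])
  qed
  moreover have "R *\<^sub>v (C \<cdot>\<^sub>v kronv f0 g0 + S \<cdot>\<^sub>v kronv f1 g1)
      = C \<cdot>\<^sub>v kronv (U *\<^sub>v f0) (V *\<^sub>v g0) + S \<cdot>\<^sub>v kronv (U *\<^sub>v f1) (V *\<^sub>v g1)"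
  proof -
    have "R *\<^sub>v (C \<cdot>\<^sub>v kronv f0 g0 + S \<cdot>\<^sub>v kronv f1 g1)
      = C \<cdot>\<^sub>v (R *\<^sub>v kronv f0 g0) + S \<cdot>\<^sub>v (R *\<^sub>v kronv f1 g1)"
      using RD car by (subst mult_add_distrib_mat_vec[of _ "dA * dB" "dA * dB"])
        (auto simp: mult_mat_vec[of _ "dA * dB" "dA * dB"])
    then show ?thesis unfolding R_def using UD VD car by (simp add: kron_mult_kronv[of _ dA dA _ dB dB])
  qed
  ultimately have "mexp ((- \<i> * complex_of_real t) \<cdot>\<^sub>m H) *\<^sub>v kronv (U *\<^sub>v e) (V *\<^sub>v e')
      = C \<cdot>\<^sub>v kronv (U *\<^sub>v f0) (V *\<^sub>v g0) + S \<cdot>\<^sub>v kronv (U *\<^sub>v f1) (V *\<^sub>v g1)"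
    by (simp only: evo)
  moreover have "vnorm (U *\<^sub>v e) = 1" "vnorm (V *\<^sub>v e') = 1"
    using norm1 ips vnorm_unitary[OF U car(1)] vnorm_unitary[OF V car(2)] by auto
  moreover have "U *\<^sub>v w \<in> carrier_vec dA" if "w \<in> carrier_vec dA" for w using UD(1) that by simp
  moreover have "V *\<^sub>v w \<in> carrier_vec dB" if "w \<in> carrier_vec dB" for w using VD(1) that by simp
  ultimately show ?thesis
    unfolding C_def S_def
    apply (rule_tac exI[of _ "U *\<^sub>v e"], rule_tac exI[of _ "V *\<^sub>v e'"])
    apply (rule_tac exI[of _ "U *\<^sub>v f0"], rule_tac exI[of _ "U *\<^sub>v f1"])
    apply (rule_tac exI[of _ "V *\<^sub>v g0"], rule_tac exI[of _ "V *\<^sub>v g1"])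
    by (simp only: car ips cinner_unitary[OF U] cinner_unitary[OF V] simp_thms)
qed

text \<open>Three vectors are compared: the exact target output, the protocol's output (within
  \<open>eps\<close> of it), and a product vector within a * b * T of the protocol's output. Their
  overlap bound makes the first and the last far apart.\<close>

lemma implementable_imp_time_bound:
  assumes U: "unitary dA U" and V: "unitary dB V"
    and HA: "HA = U * diagonal dA (\<lambda>i. complex_of_real (x i)) * adj U" and HB: "HB = V * diagonal dB (\<lambda>i. complex_of_real (y i)) * adj V"
    and x: "\<And>i. i < dA \<Longrightarrow> \<bar>x i - cA\<bar> \<le> a" and y: "\<And>j. j < dB \<Longrightarrow> \<bar>y j - cB\<bar> \<le> b"
    and a: "0 \<le> a" and b: "0 \<le> b" and eps: "0 \<le> eps"
    and U': "unitary dA' U'" and V': "unitary dB' V'"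
    and H': "H' = kron (U' * diagonal dA' (\<lambda>i. complex_of_real (x' i)) * adj U') (V' * diagonal dB' (\<lambda>i. complex_of_real (y' i)) * adj V')"
    and kl: "k < dA'" "l < dA'" "k \<noteq> l" "x' k = cA' + a'" "x' l = cA' - a'"
    and mn: "m < dB'" "n < dB'" "m \<noteq> n" "y' m = cB' + b'" "y' n = cB' - b'"
    and t: "0 \<le> t * (a' * b')" "t * (a' * b') \<le> pi / 4"
    and impl: "implementable dA dB (kron HA HB) T dA' dB' (mexp ((- \<i> * complex_of_real t) \<cdot>\<^sub>m H')) eps"
  shows "2 - 2 * cos (t * (a' * b')) \<le> (a * b * T + eps)\<^sup>2"
proof -
  obtain p q f0 f1 g0 g1 where pq: "p \<in> carrier_vec dA'" "vnorm p = 1" "q \<in> carrier_vec dB'" "vnorm q = 1"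
    and f: "f0 \<in> carrier_vec dA'" "f1 \<in> carrier_vec dA'" "cinner f0 f0 = 1" "cinner f1 f1 = 1" "cinner f0 f1 = 0"
    and g: "g0 \<in> carrier_vec dB'" "g1 \<in> carrier_vec dB'" "cinner g0 g0 = 1" "cinner g1 g1 = 1" "cinner g0 g1 = 0"
    and chi: "mexp ((- \<i> * complex_of_real t) \<cdot>\<^sub>m H') *\<^sub>v kronv p q
      = complex_of_real (cos (t * (a' * b'))) \<cdot>\<^sub>v kronv f0 g0 + (- \<i> * complex_of_real (sin (t * (a' * b')))) \<cdot>\<^sub>v kronv f1 g1"
    using product_evolution_schmidt[OF U' V' kl mn H', of t] by blast
  define chi' where "chi' = complex_of_real (cos (t * (a' * b'))) \<cdot>\<^sub>v kronv f0 g0 + (- \<i> * complex_of_real (sin (t * (a' * b')))) \<cdot>\<^sub>v kronv f1 g1"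
  define psi where "psi = kronv p q"
  have psi: "psi \<in> carrier_vec (dA' * dB')" "vnorm psi = 1"
    using pq vnorm_kronv[OF pq(1,3)] by (auto simp: psi_def)
  have chi'c: "chi' \<in> carrier_vec (dA' * dB')" using f g by (auto simp: chi'_def)
  define R where "R = kron U' V'"
  have R: "unitary (dA' * dB') R" unfolding R_def by (rule unitary_kron[OF U' V'])
  have uM: "unitary (dA' * dB') (mexp ((- \<i> * complex_of_real t) \<cdot>\<^sub>m H'))"
    unfolding H' kron_conj_diagonal[OF U' V'] R_def[symmetric] mexp_conj[OF R]
    by (intro unitary_mult unitary_adj R unitary_diagonal) (simp add: norm_exp_eq_Re)
  have chi'n: "vnorm chi' = 1"
    using vnorm_unitary[OF uM psi(1)] psi(2) unfolding psi_def chi chi'_def by simp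
  obtain ra rb ea eb alpha beta phi steps UAf UBf where
    dims: "dA * ra = dA' * ea" "dB * rb = dB' * eb"
    and alpha: "alpha \<in> carrier_vec ea" "vnorm alpha = 1" and beta: "beta \<in> carrier_vec eb" "vnorm beta = 1"
    and phi: "phi \<in> carrier_vec (ea * eb)" "vnorm phi = 1"
    and steps: "\<forall>(UA, UB, t) \<in> set steps. unitary (dA * ra) UA \<and> unitary (dB * rb) UB \<and> 0 \<le> t"
    and T: "(\<Sum>(UA, UB, t) \<leftarrow> steps. t) \<le> T"
    and Uf: "unitary (dA * ra) UAf" "unitary (dB * rb) UBf"
    and err: "\<forall>psi \<in> carrier_vec (dA' * dB').
          vnorm (kron UAf UBf * run_steps (dA * ra * (dB * rb)) (lift_ham dA dB (kron HA HB) ra rb) steps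
                   *\<^sub>v embed_in dA' dB' ea eb psi alpha beta
                 - embed_out dA' dB' ea eb (mexp ((- \<i> * complex_of_real t) \<cdot>\<^sub>m H') *\<^sub>v psi) phi) \<le> eps * vnorm psi"
    using impl unfolding implementable_def by blast
  let ?nA = "dA * ra" and ?nB = "dB * rb"
  let ?N = "?nA * ?nB"
  define HL where "HL = lift_ham dA dB (kron HA HB) ra rb"
  define W where "W = run_steps ?N HL steps"
  have car: "HA \<in> carrier_mat dA dA" "HB \<in> carrier_mat dB dB"
    using unitaryD[OF U] unitaryD[OF V] by (auto simp: HA HB)
  have HL: "HL = kron (kron U (1\<^sub>m ra) * diagonal ?nA (\<lambda>i. complex_of_real (x (i div ra))) * adj (kron U (1\<^sub>m ra)))
     (kron V (1\<^sub>m rb) * diagonal ?nB (\<lambda>i. complex_of_real (y (i div rb))) * adj (kron V (1\<^sub>m rb)))"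
    unfolding HL_def lift_ham_kron[OF car] unfolding HA HB kron_one_conj_diagonal[OF U] kron_one_conj_diagonal[OF V] ..
  note near = run_steps_near_local[OF unitary_kron[OF U unitary_one[of ra]] unitary_kron[OF V unitary_one[of rb]] _ _ a b HL steps,
      of cA cB, folded W_def]
  have "unitary ?N W \<and> (\<exists>LA LB. unitary ?nA LA \<and> unitary ?nB LB \<and>
       (\<forall>v\<in>carrier_vec ?N. vnorm (W *\<^sub>v v - kron LA LB *\<^sub>v v) \<le> a * b * (\<Sum>(UA, UB, t) \<leftarrow> steps. t) * vnorm v))"
    by (rule near) (auto intro!: x y div_less_of_mult)
  then obtain LA LB where W: "unitary ?N W" and L: "unitary ?nA LA" "unitary ?nB LB"
    and WL: "\<And>v. v \<in> carrier_vec ?N \<Longrightarrow> vnorm (W *\<^sub>v v - kron LA LB *\<^sub>v v) \<le> a * b * (\<Sum>(UA, UB, t) \<leftarrow> steps. t) * vnorm v"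
    by blast
  define pa where "pa = kronv p alpha"
  define pb where "pb = kronv q beta"
  have pa: "pa \<in> carrier_vec ?nA" "vnorm pa = 1" and pb: "pb \<in> carrier_vec ?nB" "vnorm pb = 1"
    using pq alpha beta vnorm_kronv[OF pq(1) alpha(1)] vnorm_kronv[OF pq(3) beta(1)]
    by (auto simp: pa_def pb_def dims)
  define v where "v = kronv pa pb"
  have v: "v \<in> carrier_vec ?N" "vnorm v = 1"
    using pa pb vnorm_kronv[OF pa(1) pb(1)] by (auto simp: v_def)
  have emb: "embed_in dA' dB' ea eb psi alpha beta = v"
    unfolding psi_def v_def pa_def pb_def by (rule embed_in_kronv[OF pq(1,3) alpha(1) beta(1)])
  define out where "out = embed_out dA' dB' ea eb chi' phi"
  have out: "out \<in> carrier_vec ?N" "vnorm out = 1"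
    using vnorm_embed_out[OF chi'c phi(1)] chi'n phi(2) by (auto simp: out_def dims)
  note uF = unitary_kron[OF Uf] and uL = unitary_kron[OF L]
  note cm = unitaryD(1)[OF uF] unitaryD(1)[OF uL] unitaryD(1)[OF W] unitaryD(1)[OF Uf(1)] unitaryD(1)[OF Uf(2)]
    unitaryD(1)[OF L(1)] unitaryD(1)[OF L(2)]
  define qa where "qa = UAf *\<^sub>v (LA *\<^sub>v pa)"
  define qb where "qb = UBf *\<^sub>v (LB *\<^sub>v pb)"
  have LApa: "LA *\<^sub>v pa \<in> carrier_vec ?nA" "LB *\<^sub>v pb \<in> carrier_vec ?nB" using cm pa pb by auto
  have qa: "qa \<in> carrier_vec ?nA" "vnorm qa = 1" and qb: "qb \<in> carrier_vec ?nB" "vnorm qb = 1"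
    using cm LApa vnorm_unitary[OF Uf(1) LApa(1)] vnorm_unitary[OF Uf(2) LApa(2)]
      vnorm_unitary[OF L(1) pa(1)] vnorm_unitary[OF L(2) pb(1)] pa(2) pb(2)
    by (auto simp: qa_def qb_def)
  \<comment> \<open>The comparison vector stays a product because the input, the approximating
    unitaries and the final ones all are.\<close>
  have qq: "kronv qa qb = kron UAf UBf *\<^sub>v (kron LA LB *\<^sub>v v)"
    unfolding v_def qa_def qb_def
    using kron_mult_kronv[OF cm(6,7) pa(1) pb(1)] kron_mult_kronv[OF cm(4,5) LApa] by simp
  have Wv: "W *\<^sub>v v \<in> carrier_vec ?N" and Lv: "kron LA LB *\<^sub>v v \<in> carrier_vec ?N" using cm v by auto
  have e1: "vnorm (kron UAf UBf *\<^sub>v (W *\<^sub>v v) - out) \<le> eps"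
  proof -
    have "mexp ((- \<i> * complex_of_real t) \<cdot>\<^sub>m H') *\<^sub>v psi = chi'"
      unfolding psi_def chi chi'_def ..
    then show ?thesis
      using err[rule_format, OF psi(1)] assoc_mult_mat_vec[OF cm(1,3) v(1)]
      by (simp only: emb out_def psi(2) mult_1_right flip: W_def HL_def)
  qed
  have e2: "vnorm (kron UAf UBf *\<^sub>v (kron LA LB *\<^sub>v v) - kron UAf UBf *\<^sub>v (W *\<^sub>v v)) \<le> a * b * T"
  proof -
    have "kron UAf UBf *\<^sub>v (kron LA LB *\<^sub>v v) - kron UAf UBf *\<^sub>v (W *\<^sub>v v) = kron UAf UBf *\<^sub>v (kron LA LB *\<^sub>v v - W *\<^sub>v v)"
      using cm Wv Lv by (intro mult_minus_distrib_mat_vec[symmetric, of _ ?N ?N]) auto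
    then have "vnorm (kron UAf UBf *\<^sub>v (kron LA LB *\<^sub>v v) - kron UAf UBf *\<^sub>v (W *\<^sub>v v)) = vnorm (kron LA LB *\<^sub>v v - W *\<^sub>v v)"
      using vnorm_unitary[OF uF, of "kron LA LB *\<^sub>v v - W *\<^sub>v v"] Wv Lv by simp
    also have "\<dots> = vnorm (W *\<^sub>v v - kron LA LB *\<^sub>v v)" by (rule vnorm_minus_commute[OF Lv Wv])
    also have "\<dots> \<le> a * b * (\<Sum>(UA, UB, t) \<leftarrow> steps. t)" using WL[OF v(1)] v(2) by simp
    also have "\<dots> \<le> a * b * T" using T a b by (intro mult_left_mono) auto
    finally show ?thesis .
  qed
  have dist: "vnorm (kronv qa qb - out) \<le> a * b * T + eps"
    using vnorm_triangle_diff[of "kronv qa qb" ?N "kron UAf UBf *\<^sub>v (W *\<^sub>v v)" out] e1 e2 qa qb out cm Wv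
    unfolding qq[symmetric] by simp
  \<comment> \<open>Up to angle pi / 4 the cosine dominates the sine, so it is the larger Schmidt
    coefficient.\<close>
  have cos0: "\<bar>sin (t * (a' * b'))\<bar> \<le> cos (t * (a' * b'))" "0 \<le> cos (t * (a' * b'))"
  proof -
    let ?z = "t * (a' * b')"
    show c: "0 \<le> cos ?z" using t pi_gt_zero by (intro cos_ge_zero) linarith+
    have "0 \<le> cos (2 * ?z)" using t pi_gt_zero by (intro cos_ge_zero) linarith+
    then have "(sin ?z)\<^sup>2 \<le> (cos ?z)\<^sup>2" by (simp add: cos_double)
    then show "\<bar>sin ?z\<bar> \<le> cos ?z" using c by (metis abs_le_square_iff abs_of_nonneg)
  qed
  have "cmod (cinner (kronv qa qb) out) \<le> cos (t * (a' * b'))"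
    unfolding out_def chi'_def
    using qa qb cos0 by (intro product_overlap_le[OF _ _ _ _ phi f g]) (auto simp: dims norm_mult)
  then have "2 - 2 * cos (t * (a' * b')) \<le> (vnorm (kronv qa qb - out))\<^sup>2"
    using qa qb out vnorm_kronv[OF qa(1) qb(1)] by (intro vnorm_diff_ge[of _ ?N]) auto
  also have "\<dots> \<le> (a * b * T + eps)\<^sup>2" using dist by (intro power_mono) auto
  finally show ?thesis .
qed

section \<open>Exact simulation\<close>

text \<open>Exact counterpart of \<open>implementable\<close>: an equality of operators on the whole
  laboratory with T the exact interaction time, so that multiplying operators adds times.\<close>

definition realizable :: "nat \<Rightarrow> nat \<Rightarrow> complex mat \<Rightarrow> real \<Rightarrow> complex mat \<Rightarrow> bool" where
  "realizable nA nB HL T M \<longleftrightarrow> (\<exists>steps UA UB.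
     (\<forall>(UA, UB, t) \<in> set steps. unitary nA UA \<and> unitary nB UB \<and> 0 \<le> t) \<and>
     (\<Sum>(UA, UB, t) \<leftarrow> steps. t) = T \<and> unitary nA UA \<and> unitary nB UB \<and>
     M = kron UA UB * run_steps (nA * nB) HL steps)"

lemma one_mult_square [simp]:
  fixes A :: "complex mat"
  assumes "A \<in> carrier_mat n n"
  shows "1\<^sub>m n * A = A" "A * 1\<^sub>m n = A"
  using assms by simp_all

lemma mexp_carrier [simp]: "A \<in> carrier_mat n n \<Longrightarrow> mexp A \<in> carrier_mat n n"
  by (auto simp: mexp_def)

lemma run_steps_carrier:
  assumes "HL \<in> carrier_mat (nA * nB) (nA * nB)"
  shows "(\<forall>(UA, UB, t) \<in> set steps. unitary nA UA \<and> unitary nB UB \<and> 0 \<le> t) \<Longrightarrow>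
    run_steps (nA * nB) HL steps \<in> carrier_mat (nA * nB) (nA * nB)"
proof (induction steps)
  case (Cons s steps)
  obtain UA UB t where s: "s = (UA, UB, t)" by (cases s) auto
  have "kron UA UB \<in> carrier_mat (nA * nB) (nA * nB)"
    using Cons.prems s unitaryD(1) by (intro kron_carrier) auto
  then show ?case using Cons assms by (auto simp: s)
qed simp

lemma run_steps_append:
  assumes HL: "HL \<in> carrier_mat (nA * nB) (nA * nB)"
    and ys: "\<forall>(UA, UB, t) \<in> set ys. unitary nA UA \<and> unitary nB UB \<and> 0 \<le> t"
  shows "(\<forall>(UA, UB, t) \<in> set xs. unitary nA UA \<and> unitary nB UB \<and> 0 \<le> t) \<Longrightarrow>
    run_steps (nA * nB) HL (xs @ ys) = run_steps (nA * nB) HL ys * run_steps (nA * nB) HL xs"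
proof (induction xs)
  case Nil
  then show ?case using run_steps_carrier[OF HL ys] by simp
next
  case (Cons s xs)
  obtain UA UB t where s: "s = (UA, UB, t)" by (cases s) auto
  have K: "kron UA UB \<in> carrier_mat (nA * nB) (nA * nB)"
    using Cons.prems s unitaryD(1) by (intro kron_carrier) auto
  have X: "run_steps (nA * nB) HL xs \<in> carrier_mat (nA * nB) (nA * nB)"
    using Cons.prems by (intro run_steps_carrier[OF HL]) auto
  show ?case
    using Cons run_steps_carrier[OF HL ys] X K HL
    by (simp add: s assoc_mult_mat[of _ "nA * nB" "nA * nB" _ "nA * nB" _ "nA * nB"])
qed

lemma realizable_local:
  assumes "unitary nA UA" "unitary nB UB"
  shows "realizable nA nB HL 0 (kron UA UB)"
  unfolding realizable_def
  by (rule exI[of _ "[]"], rule exI[of _ UA], rule exI[of _ UB])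
    (use assms unitaryD(1)[OF unitary_kron[OF assms]] in simp)

lemma realizable_evolve:
  assumes "HL \<in> carrier_mat (nA * nB) (nA * nB)" "0 \<le> t"
  shows "realizable nA nB HL t (mexp ((- \<i> * complex_of_real t) \<cdot>\<^sub>m HL))"
  unfolding realizable_def
  by (rule exI[of _ "[(1\<^sub>m nA, 1\<^sub>m nB, t)]"], rule exI[of _ "1\<^sub>m nA"], rule exI[of _ "1\<^sub>m nB"])
    (use assms in \<open>simp add: kron_one\<close>)

text \<open>The closing local unitary of the first protocol is merged into the opening one of the
  second, or into its closing one if the second has no steps. Merging costs no interaction
  time.\<close>

lemma realizable_mult:
  assumes HL: "HL \<in> carrier_mat (nA * nB) (nA * nB)"
    and 1: "realizable nA nB HL T1 M1" and 2: "realizable nA nB HL T2 M2"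
  shows "realizable nA nB HL (T1 + T2) (M2 * M1)"
proof -
  let ?N = "nA * nB"
  let ?ok = "\<lambda>steps. \<forall>(UA, UB, t) \<in> set steps. unitary nA UA \<and> unitary nB UB \<and> 0 \<le> t"
  obtain xs UA UB where xs: "?ok xs" "(\<Sum>(UA, UB, t) \<leftarrow> xs. t) = T1"
    and U: "unitary nA UA" "unitary nB UB" and M1: "M1 = kron UA UB * run_steps ?N HL xs"
    using 1 unfolding realizable_def by blast
  obtain ys VA VB where ys: "?ok ys" "(\<Sum>(UA, UB, t) \<leftarrow> ys. t) = T2"
    and V: "unitary nA VA" "unitary nB VB" and M2: "M2 = kron VA VB * run_steps ?N HL ys"
    using 2 unfolding realizable_def by blast
  note cU = unitaryD(1)[OF U(1)] unitaryD(1)[OF U(2)] and cV = unitaryD(1)[OF V(1)] unitaryD(1)[OF V(2)]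
  note K = kron_carrier[OF cU] kron_carrier[OF cV]
  note X = run_steps_carrier[OF HL xs(1)]
  have kk: "kron (WA * UA) (WB * UB) = kron WA WB * kron UA UB" if "unitary nA WA" "unitary nB WB" for WA WB
    using kron_mult[OF unitaryD(1)[OF that(1)] unitaryD(1)[OF that(2)] cU] by simp
  show ?thesis
  proof (cases ys)
    case Nil
    have "M2 * M1 = kron (VA * UA) (VB * UB) * run_steps ?N HL xs"
      unfolding M1 M2 kk[OF V] using K X by (simp add: Nil assoc_mult_mat[of _ ?N ?N _ ?N _ ?N])
    moreover have "T1 + T2 = T1" using ys Nil by simp
    ultimately show ?thesis
      unfolding realizable_def using xs unitary_mult[OF V(1) U(1)] unitary_mult[OF V(2) U(2)] by metis
  next
    case (Cons s zs)
    obtain WA WB t where s: "s = (WA, WB, t)" by (cases s) auto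
    have W: "unitary nA WA" "unitary nB WB" "0 \<le> t" and zs: "?ok zs" using ys(1) Cons s by auto
    note KW = kron_carrier[OF unitaryD(1)[OF W(1)] unitaryD(1)[OF W(2)]]
    note Z = run_steps_carrier[OF HL zs]
    define E where "E = mexp ((- \<i> * complex_of_real t) \<cdot>\<^sub>m HL)"
    have E: "E \<in> carrier_mat ?N ?N" using HL by (simp add: E_def)
    define ws where "ws = xs @ (WA * UA, WB * UB, t) # zs"
    have tl: "?ok ((WA * UA, WB * UB, t) # zs)"
      using zs W(3) unitary_mult[OF W(1) U(1)] unitary_mult[OF W(2) U(2)] by simp
    have "run_steps ?N HL ws = run_steps ?N HL zs * (E * kron (WA * UA) (WB * UB)) * run_steps ?N HL xs"
      unfolding ws_def run_steps_append[OF HL tl xs(1)] by (simp add: E_def)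
    moreover have "run_steps ?N HL ys = run_steps ?N HL zs * (E * kron WA WB)"
      by (simp add: Cons s E_def)
    ultimately have "kron VA VB * run_steps ?N HL ws = M2 * M1"
      unfolding M1 M2 kk[OF W(1,2)] using K KW X Z E
      by (simp add: assoc_mult_mat[of _ ?N ?N _ ?N _ ?N])
    moreover have "?ok ws" using tl xs(1) by (auto simp: ws_def)
    moreover have "(\<Sum>(UA, UB, t) \<leftarrow> ws. t) = T1 + T2" using xs(2) ys(2) by (simp add: ws_def Cons s)
    ultimately show ?thesis unfolding realizable_def using V by metis
  qed
qed

section \<open>Relabelled eigenbases, sign functions and code states\<close>

definition perm_mat :: "nat \<Rightarrow> (nat \<Rightarrow> nat) \<Rightarrow> complex mat" where
  "perm_mat n \<pi> = mat n n (\<lambda>(i, j). if i = \<pi> j then 1 else 0)"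

lemma conj_perm_mat:
  assumes "inj_on \<pi> {..<n}" "\<pi> ` {..<n} \<subseteq> {..<n}"
  shows "adj (perm_mat n \<pi>) * diagonal n f * perm_mat n \<pi> = diagonal n (\<lambda>i. f (\<pi> i))"
proof (rule eq_matI)
  have pmc: "perm_mat n \<pi> \<in> carrier_mat n n" by (simp add: perm_mat_def)
  fix i j assume "i < dim_row (diagonal n (\<lambda>i. f (\<pi> i)))" "j < dim_col (diagonal n (\<lambda>i. f (\<pi> i)))"
  then have ij: "i < n" "j < n" by auto
  then have pij: "\<pi> i < n" "\<pi> j < n" using assms(2) by auto
  have L: "(adj (perm_mat n \<pi>) * diagonal n f) $$ (i, l) = (if l = \<pi> i then f l else 0)" if "l < n" for l
  proof -
    have "(adj (perm_mat n \<pi>) * diagonal n f) $$ (i, l) = (\<Sum>m<n. if m = l then (if l = \<pi> i then f l else 0) else 0)"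
      unfolding mult_mat_index[OF adj_carrier[OF pmc] diagonal_carrier ij(1) that]
      by (rule sum.cong) (use ij that in \<open>auto simp: adj_index[OF pmc] diagonal_index\<close>, auto simp: perm_mat_def)
    then show ?thesis using that by simp
  qed
  have "(adj (perm_mat n \<pi>) * diagonal n f * perm_mat n \<pi>) $$ (i, j) = (\<Sum>l<n. if l = \<pi> i then (if \<pi> i = \<pi> j then f l else 0) else 0)"
    unfolding mult_mat_index[OF mult_square_carrier[OF adj_carrier[OF pmc] diagonal_carrier] pmc ij]
    by (rule sum.cong) (use ij in \<open>auto simp: L simp del: index_mult_mat\<close>, auto simp: perm_mat_def)
  also have "\<dots> = diagonal n (\<lambda>i. f (\<pi> i)) $$ (i, j)"
    using ij pij assms(1) by (auto simp: diagonal_index inj_on_def)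
  finally show "(adj (perm_mat n \<pi>) * diagonal n f * perm_mat n \<pi>) $$ (i, j) = diagonal n (\<lambda>i. f (\<pi> i)) $$ (i, j)" .
qed (auto simp: perm_mat_def)

lemma unitary_perm_mat:
  assumes "inj_on \<pi> {..<n}" "\<pi> ` {..<n} \<subseteq> {..<n}"
  shows "unitary n (perm_mat n \<pi>)"
proof -
  have c: "perm_mat n \<pi> \<in> carrier_mat n n" by (simp add: perm_mat_def)
  show ?thesis using conj_perm_mat[OF assms, of "\<lambda>_. 1"] c by (simp add: unitary_def diagonal_one)
qed

text \<open>The operator is unchanged; only its eigenbasis is relabelled. This gives the freedom to
  decide which eigenvalue of the resource sits at which laboratory index.\<close>

lemma conj_diagonal_permute:
  assumes P: "unitary n P" and \<pi>: "inj_on \<pi> {..<n}" "\<pi> ` {..<n} \<subseteq> {..<n}"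
  shows "P * diagonal n f * adj P = (P * perm_mat n \<pi>) * diagonal n (\<lambda>i. f (\<pi> i)) * adj (P * perm_mat n \<pi>)"
proof -
  let ?M = "perm_mat n \<pi>"
  note P = unitaryD[OF P] and M = unitaryD[OF unitary_perm_mat[OF \<pi>]]
  note asc = assoc_mult_mat[of _ n n _ n _ n]
  have "(P * ?M) * (adj ?M * diagonal n f * ?M) * adj (P * ?M) = (P * ?M) * (adj ?M * diagonal n f * ?M * (adj ?M * adj P))"
    using P M by (simp add: asc adj_mult[of _ n n _ n])
  also have "adj ?M * diagonal n f * ?M * (adj ?M * adj P) = adj ?M * diagonal n f * adj P"
    using P M by (intro mult_cancel_middle[of _ n]) auto
  also have "\<dots> = adj ?M * (diagonal n f * adj P)" using P M by (simp add: asc)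
  also have "P * ?M * (adj ?M * (diagonal n f * adj P)) = P * (diagonal n f * adj P)"
    using P M by (intro mult_cancel_middle[of _ n]) auto
  also have "\<dots> = P * diagonal n f * adj P" using P M by (simp add: asc)
  finally show ?thesis unfolding conj_perm_mat[OF \<pi>] ..
qed

text \<open>Every point of a cube is reached from its vertices by repeated two-point convex
  combinations, one coordinate at a time; \<open>A\<close> holds the coordinates that may still be
  strictly inside. No weights for all vertices have to be written down.\<close>

lemma convex_sign_induct:
  fixes P :: "('a \<Rightarrow> real) \<Rightarrow> bool"
  assumes signs: "\<And>s. (\<And>i. s i = 1 \<or> s i = -1) \<Longrightarrow> P s"
    and conv: "\<And>s s' c. 0 \<le> c \<Longrightarrow> c \<le> 1 \<Longrightarrow> P s \<Longrightarrow> P s' \<Longrightarrow> P (\<lambda>i. c * s i + (1 - c) * s' i)"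
    and "finite A" and "\<And>i. \<bar>u i\<bar> \<le> 1" and "\<And>i. i \<notin> A \<Longrightarrow> u i = 1 \<or> u i = -1"
  shows "P u"
  using assms(3-5)
proof (induction A arbitrary: u rule: finite_induct)
  case empty
  then show ?case by (intro signs) auto
next
  case (insert a A)
  have "P (u(a := \<sigma>))" if "\<sigma> = 1 \<or> \<sigma> = -1" for \<sigma>
    using insert.prems that by (intro insert.IH) auto
  \<comment> \<open>The weight (1 + u a) / 2 on +1 and the rest on -1 average to u a.\<close>
  then have "P (\<lambda>i. ((1 + u a) / 2) * (u(a := 1)) i + (1 - (1 + u a) / 2) * (u(a := -1)) i)"
    using insert.prems(1)[of a] by (intro conv[of "(1 + u a) / 2" "u(a := 1)" "u(a := -1)"]) (auto simp: abs_le_iff simp del: fun_upd_apply)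
  moreover have "(\<lambda>i. ((1 + u a) / 2) * (u(a := 1)) i + (1 - (1 + u a) / 2) * (u(a := -1)) i) = u"
    by (rule ext) (auto simp: field_simps)
  ultimately show ?case by simp
qed

text \<open>Reads an index as target digit j div d and ancilla digit j mod d, and returns one whose
  quotient by d' is the resource digit. The transposition, controlled by the target digit, moves
  ancilla 0 to \<kappa>; using a transposition keeps the map a bijection for arbitrary, even
  constant, \<kappa>.\<close>

definition code_perm :: "nat \<Rightarrow> nat \<Rightarrow> (nat \<Rightarrow> nat) \<Rightarrow> nat \<Rightarrow> nat" where
  "code_perm d d' \<kappa> j = transpose 0 (\<kappa> (j div d)) (j mod d) * d' + j div d"

lemma code_perm:
  assumes \<kappa>: "\<And>i. i < d' \<Longrightarrow> \<kappa> i < d"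
  shows "inj_on (code_perm d d' \<kappa>) {..<d' * d}" "code_perm d d' \<kappa> ` {..<d' * d} \<subseteq> {..<d' * d}"
proof -
  have quot: "j div d < d'" and less: "transpose 0 (\<kappa> (j div d)) (j mod d) < d" if "j < d' * d" for j
  proof -
    show q: "j div d < d'" by (rule div_less_of_mult[OF that])
    show "transpose 0 (\<kappa> (j div d)) (j mod d) < d"
      using \<kappa>[OF q] mod_less_of_mult[OF that] by (auto simp: transpose_def)
  qed
  have md: "code_perm d d' \<kappa> j mod d' = j div d" "code_perm d d' \<kappa> j div d' = transpose 0 (\<kappa> (j div d)) (j mod d)"
    if "j < d' * d" for j
    using quot[OF that] by (auto simp: code_perm_def)
  show "inj_on (code_perm d d' \<kappa>) {..<d' * d}"
  proof (rule inj_onI)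
    fix i j assume "i \<in> {..<d' * d}" "j \<in> {..<d' * d}" and eq: "code_perm d d' \<kappa> i = code_perm d d' \<kappa> j"
    then have ij: "i < d' * d" "j < d' * d" by auto
    have 1: "i div d = j div d" using md(1)[OF ij(1)] md(1)[OF ij(2)] eq by simp
    then have "transpose 0 (\<kappa> (j div d)) (i mod d) = transpose 0 (\<kappa> (j div d)) (j mod d)"
      using md(2)[OF ij(1)] md(2)[OF ij(2)] eq by simp
    then have "i mod d = j mod d" by (metis transpose_involutory)
    with 1 show "i = j" by (metis div_mult_mod_eq)
  qed
  show "code_perm d d' \<kappa> ` {..<d' * d} \<subseteq> {..<d' * d}"
    using index_less_mult[OF less quot] by (auto simp: code_perm_def mult.commute[of d' d])
qed

lemma code_perm_code: "i < d' \<Longrightarrow> 0 < d \<Longrightarrow> code_perm d d' \<kappa> (i * d) div d' = \<kappa> i"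
  by (simp add: code_perm_def)

text \<open>Each laboratory is resource times target: the target dimension serves as the ancilla of
  the resource and the resource dimension as the ancilla of the target, so both readings of the
  laboratory have equal dimension.\<close>

locale product_lab =
  fixes dA dB dA' dB' :: nat and U V :: "complex mat" and x y :: "nat \<Rightarrow> real" and HL :: "complex mat"
  assumes pos: "0 < dA" "0 < dB"
    and U: "unitary dA U" and V: "unitary dB V"
    and resource: "HL = kron (kron (U * diagonal dA (\<lambda>i. complex_of_real (x i)) * adj U) (1\<^sub>m dA'))
      (kron (V * diagonal dB (\<lambda>i. complex_of_real (y i)) * adj V) (1\<^sub>m dB'))"
begin

abbreviation "nA \<equiv> dA' * dA"
abbreviation "nB \<equiv> dB' * dB"

lemma HL_carrier: "HL \<in> carrier_mat (nA * nB) (nA * nB)"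
proof -
  have "HL \<in> carrier_mat (dA * dA' * (dB * dB')) (dA * dA' * (dB * dB'))"
    unfolding resource using unitaryD[OF U] unitaryD[OF V] by (intro kron_carrier) auto
  then show ?thesis by (simp add: mult.commute)
qed

text \<open>The laboratory index (i * dA + a) carries the target system i and an ancilla a; a target basis
  state together with the ancilla state 0 is a code state. All controls used here keep the evolution
  diagonal, so that only its phases on code states have to be tracked.\<close>

definition reach :: "real \<Rightarrow> (nat \<Rightarrow> nat \<Rightarrow> real) \<Rightarrow> bool" where
  "reach T F \<longleftrightarrow> (\<exists>f. realizable nA nB HL T (diagonal (nA * nB) f) \<and>
     (\<forall>i<dA'. \<forall>j<dB'. f ((i * dA) * nB + j * dB) = cis (F i j)))"

lemma reach_cong: "reach T F \<Longrightarrow> (\<And>i j. i < dA' \<Longrightarrow> j < dB' \<Longrightarrow> F i j = G i j) \<Longrightarrow> reach T G"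
  unfolding reach_def by metis

lemma reach_add:
  assumes "reach T F" "reach S G"
  shows "reach (T + S) (\<lambda>i j. F i j + G i j)"
proof -
  obtain f where f: "realizable nA nB HL T (diagonal (nA * nB) f)" "\<And>i j. i < dA' \<Longrightarrow> j < dB' \<Longrightarrow> f ((i * dA) * nB + j * dB) = cis (F i j)"
    using assms(1) unfolding reach_def by blast
  obtain g where g: "realizable nA nB HL S (diagonal (nA * nB) g)" "\<And>i j. i < dA' \<Longrightarrow> j < dB' \<Longrightarrow> g ((i * dA) * nB + j * dB) = cis (G i j)"
    using assms(2) unfolding reach_def by blast
  have "realizable nA nB HL (T + S) (diagonal (nA * nB) (\<lambda>k. g k * f k))"
    using realizable_mult[OF HL_carrier f(1) g(1)] by simp
  then show ?thesis unfolding reach_def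
    by (intro exI[of _ "\<lambda>k. g k * f k"]) (simp add: f(2) g(2) cis_mult add.commute[of "G _ _"])
qed

lemma code_less: "i < dA' \<Longrightarrow> i * dA < nA" "j < dB' \<Longrightarrow> j * dB < nB"
  using index_less_mult[of i dA' 0 dA] index_less_mult[of j dB' 0 dB] pos by auto

text \<open>Phases depending on one party's target index are free of interaction time; they absorb
  every centring term below.\<close>

lemma reach_local: "reach 0 (\<lambda>i j. g i + h j)"
proof -
  let ?LA = "diagonal nA (\<lambda>k. cis (g (k div dA)))" and ?LB = "diagonal nB (\<lambda>k. cis (h (k div dB)))"
  have "realizable nA nB HL 0 (kron ?LA ?LB)"
    by (intro realizable_local unitary_diagonal) simp_all
  then have "realizable nA nB HL 0 (diagonal (nA * nB) (\<lambda>k. cis (g (k div nB div dA)) * cis (h (k mod nB div dB))))"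
    by (simp only: kron_diagonal)
  then show ?thesis unfolding reach_def
  proof (intro exI conjI allI impI)
    fix i j assume "i < dA'" "j < dB'"
    then show "cis (g (((i * dA) * nB + j * dB) div nB div dA)) * cis (h (((i * dA) * nB + j * dB) mod nB div dB)) = cis (g i + h j)"
      using code_less(2)[of j] pos by (simp add: cis_mult)
  qed
qed

text \<open>One uninterrupted use of H, read in a relabelled eigenbasis: code state (i, j) is stored
  in the resource eigenvectors \<kappa> i and \<mu> j and collects the product of their eigenvalues
  as a phase.\<close>

lemma reach_basic:
  assumes \<kappa>: "\<And>i. i < dA' \<Longrightarrow> \<kappa> i < dA" and \<mu>: "\<And>j. j < dB' \<Longrightarrow> \<mu> j < dB" and t: "0 \<le> t"
  shows "reach t (\<lambda>i j. - t * (x (\<kappa> i) * y (\<mu> j)))"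
proof -
  let ?\<pi> = "code_perm dA dA' \<kappa>" and ?\<rho> = "code_perm dB dB' \<mu>"
  define P where "P = kron U (1\<^sub>m dA') * perm_mat nA ?\<pi>"
  define Q where "Q = kron V (1\<^sub>m dB') * perm_mat nB ?\<rho>"
  have uU: "unitary nA (kron U (1\<^sub>m dA'))" "unitary nB (kron V (1\<^sub>m dB'))"
    using unitary_kron[OF U unitary_one[of dA']] unitary_kron[OF V unitary_one[of dB']] by (simp_all add: mult.commute)
  have \<pi>: "inj_on ?\<pi> {..<nA}" "?\<pi> ` {..<nA} \<subseteq> {..<nA}" by (rule code_perm[OF \<kappa>], assumption)+
  have \<rho>: "inj_on ?\<rho> {..<nB}" "?\<rho> ` {..<nB} \<subseteq> {..<nB}" by (rule code_perm[OF \<mu>], assumption)+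
  have P: "unitary nA P" and Q: "unitary nB Q"
    unfolding P_def Q_def by (intro unitary_mult uU unitary_perm_mat \<pi> \<rho>)+
  define R where "R = kron P Q"
  have R: "unitary (nA * nB) R" unfolding R_def by (rule unitary_kron[OF P Q])
  note RD = unitaryD[OF R]
  define X where "X i = complex_of_real (x (?\<pi> i div dA'))" for i
  define Y where "Y i = complex_of_real (y (?\<rho> i div dB'))" for i
  have HL: "HL = kron (P * diagonal nA X * adj P) (Q * diagonal nB Y * adj Q)"
    unfolding resource kron_one_conj_diagonal[OF U] kron_one_conj_diagonal[OF V] mult.commute[of dA dA'] mult.commute[of dB dB']
      P_def Q_def X_def Y_def conj_diagonal_permute[OF uU(1) \<pi>, of "\<lambda>k. complex_of_real (x (k div dA'))"]
      conj_diagonal_permute[OF uU(2) \<rho>, of "\<lambda>k. complex_of_real (y (k div dB'))"] ..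
  define f where "f k = exp ((- \<i> * complex_of_real t) * (X (k div nB) * Y (k mod nB)))" for k
  have E: "mexp ((- \<i> * complex_of_real t) \<cdot>\<^sub>m HL) = R * diagonal (nA * nB) f * adj R"
    unfolding HL kron_conj_diagonal[OF P Q] R_def[symmetric] mexp_conj[OF R] f_def ..
  \<comment> \<open>Entering the relabelled eigenbasis before and leaving it after the evolution
    turns the latter into a diagonal matrix.\<close>
  have "realizable nA nB HL (0 + t + 0) (kron (adj P) (adj Q) * (mexp ((- \<i> * complex_of_real t) \<cdot>\<^sub>m HL) * kron P Q))"
    by (intro realizable_mult[OF HL_carrier] realizable_local realizable_evolve HL_carrier P Q unitary_adj t)
  also have "kron (adj P) (adj Q) * (mexp ((- \<i> * complex_of_real t) \<cdot>\<^sub>m HL) * kron P Q) = diagonal (nA * nB) f"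
  proof -
    have "adj R * (R * diagonal (nA * nB) f * adj R * R) = adj R * (R * diagonal (nA * nB) f * (adj R * R))"
      using RD by (simp add: assoc_mult_mat[of _ "nA * nB" "nA * nB" _ "nA * nB" _ "nA * nB"])
    also have "\<dots> = adj R * (R * diagonal (nA * nB) f)" using RD by simp
    also have "\<dots> = (adj R * R) * diagonal (nA * nB) f"
      using RD by (intro assoc_mult_mat[symmetric, of _ "nA * nB" "nA * nB" _ "nA * nB" _ "nA * nB"]) auto
    finally show ?thesis unfolding E adj_kron[symmetric] R_def[symmetric] using RD by simp
  qed
  finally have real: "realizable nA nB HL t (diagonal (nA * nB) f)" by simp
  have "f ((i * dA) * nB + j * dB) = cis (- t * (x (\<kappa> i) * y (\<mu> j)))" if "i < dA'" "j < dB'" for i j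
  proof -
    have "((i * dA) * nB + j * dB) div nB = i * dA" "((i * dA) * nB + j * dB) mod nB = j * dB"
      using code_less(2)[OF that(2)] by auto
    then have "f ((i * dA) * nB + j * dB) = exp ((- \<i> * complex_of_real t) * (complex_of_real (x (\<kappa> i)) * complex_of_real (y (\<mu> j))))"
      by (simp only: f_def X_def Y_def code_perm_code[OF that(1) pos(1)] code_perm_code[OF that(2) pos(2)])
    then show ?thesis by (simp add: cis_conv_exp mult_ac)
  qed
  with real show ?thesis unfolding reach_def by blast
qed

text \<open>Storing i in the upper or lower extremal eigenvector gives cA + a s(i), likewise for
  Bob. In the product all terms but a b s(i) r(j) depend on one index at most and are cancelled by
  local phases.\<close>

lemma reach_signs:
  assumes x: "p < dA" "q < dA" "x p = cA + a" "x q = cA - a"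
    and y: "p' < dB" "q' < dB" "y p' = cB + b" "y q' = cB - b"
    and s: "\<And>i. s i = 1 \<or> s i = -1" and r: "\<And>i. r i = 1 \<or> r i = -1" and t: "0 \<le> t"
  shows "reach t (\<lambda>i j. - t * (a * b) * (s i * r j))"
proof -
  define \<kappa> where "\<kappa> i = (if s i = 1 then p else q)" for i :: nat
  define \<mu> where "\<mu> j = (if r j = 1 then p' else q')" for j :: nat
  have X: "x (\<kappa> i) = cA + a * s i" and Y: "y (\<mu> j) = cB + b * r j" for i j
    using s[of i] r[of j] x y by (auto simp: \<kappa>_def \<mu>_def)
  have "reach t (\<lambda>i j. - t * (x (\<kappa> i) * y (\<mu> j)))"
    using x y t by (intro reach_basic) (auto simp: \<kappa>_def \<mu>_def)
  then have "reach (t + 0) (\<lambda>i j. - t * (x (\<kappa> i) * y (\<mu> j)) + (t * cA * cB + t * cB * a * s i + t * cA * b * r j))"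
    by (intro reach_add reach_local)
  then show ?thesis unfolding add_0_right by (rule reach_cong) (simp add: X Y algebra_simps)
qed

text \<open>Both local spectra of the target are convex combinations of sign functions, and evolutions that
  are diagonal in the same basis compose without error.\<close>

lemma reach_product:
  assumes x: "p < dA" "q < dA" "x p = cA + a" "x q = cA - a"
    and y: "p' < dB" "q' < dB" "y p' = cB + b" "y q' = cB - b"
    and u: "\<And>i. i < dA' \<Longrightarrow> \<bar>u i\<bar> \<le> 1" and v: "\<And>j. j < dB' \<Longrightarrow> \<bar>v j\<bar> \<le> 1" and t: "0 \<le> t"
  shows "reach t (\<lambda>i j. - t * (a * b) * (u i * v j))"
proof -
  \<comment> \<open>Phases linear in time: spending the fractions c and 1 - c of t on two evolutions
    averages their phases at total cost t.\<close>
  have convex: "reach t (\<lambda>i j. c * F i j t + (1 - c) * G i j t)"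
    if "0 \<le> c" "c \<le> 1" "0 \<le> t" and F: "\<And>t. 0 \<le> t \<Longrightarrow> reach t (\<lambda>i j. F i j t)" "\<And>i j. F i j (c * t) = c * F i j t"
      and G: "\<And>t. 0 \<le> t \<Longrightarrow> reach t (\<lambda>i j. G i j t)" "\<And>i j. G i j ((1 - c) * t) = (1 - c) * G i j t" for c t :: real and F G
  proof -
    have "reach (c * t + (1 - c) * t) (\<lambda>i j. F i j (c * t) + G i j ((1 - c) * t))"
      by (rule reach_add[OF F(1) G(1)]) (use that(1-3) in auto)
    moreover have "c * t + (1 - c) * t = t" by (simp add: algebra_simps)
    ultimately show ?thesis by (simp only: F(2) G(2))
  qed
  \<comment> \<open>The phase is bilinear in the two functions, so convexity is used in one at a
    time: here Alice's signs are fixed while Bob's function is general.\<close>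
  have signs: "\<forall>t\<ge>0. reach t (\<lambda>i j. - t * (a * b) * (s i * w j))"
    if s: "\<And>i. s i = 1 \<or> s i = -1" and "\<And>j. \<bar>w j\<bar> \<le> 1" "\<And>j. j \<notin> {..<dB'} \<Longrightarrow> w j = 1 \<or> w j = -1" for s w :: "nat \<Rightarrow> real"
  proof (rule convex_sign_induct[of "\<lambda>w. \<forall>t\<ge>0. reach t (\<lambda>i j. - t * (a * b) * (s i * w j))" "{..<dB'}"])
    show "\<forall>t\<ge>0. reach t (\<lambda>i j. - t * (a * b) * (s i * r j))" if "\<And>i. r i = 1 \<or> r i = -1" for r
      using reach_signs[OF x y, of s r] s that by blast
    fix r r' :: "nat \<Rightarrow> real" and c :: real
    assume c: "0 \<le> c" "c \<le> 1" and r: "\<forall>t\<ge>0. reach t (\<lambda>i j. - t * (a * b) * (s i * r j))"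
      "\<forall>t\<ge>0. reach t (\<lambda>i j. - t * (a * b) * (s i * r' j))"
    show "\<forall>t\<ge>0. reach t (\<lambda>i j. - t * (a * b) * (s i * (c * r j + (1 - c) * r' j)))"
    proof (intro allI impI)
      fix t :: real assume "0 \<le> t"
      then have "reach t (\<lambda>i j. c * (- t * (a * b) * (s i * r j)) + (1 - c) * (- t * (a * b) * (s i * r' j)))"
        using convex[OF c, of t "\<lambda>i j t. - t * (a * b) * (s i * r j)" "\<lambda>i j t. - t * (a * b) * (s i * r' j)"] r by simp
      then show "reach t (\<lambda>i j. - t * (a * b) * (s i * (c * r j + (1 - c) * r' j)))"
        by (rule reach_cong) (simp add: algebra_simps)
    qed
  qed (use that in auto)
  \<comment> \<open>The sign induction concerns functions on all naturals; outside the target's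
    index range the default 1 is already a sign.\<close>
  define u' where "u' i = (if i < dA' then u i else 1)" for i
  define v' where "v' j = (if j < dB' then v j else 1)" for j
  have v': "\<And>j. \<bar>v' j\<bar> \<le> 1" "\<And>j. j \<notin> {..<dB'} \<Longrightarrow> v' j = 1 \<or> v' j = -1" using v by (auto simp: v'_def)
  have "\<forall>t\<ge>0. reach t (\<lambda>i j. - t * (a * b) * (u' i * v' j))"
  proof (rule convex_sign_induct[of "\<lambda>u'. \<forall>t\<ge>0. reach t (\<lambda>i j. - t * (a * b) * (u' i * v' j))" "{..<dA'}"])
    show "\<forall>t\<ge>0. reach t (\<lambda>i j. - t * (a * b) * (s i * v' j))" if "\<And>i. s i = 1 \<or> s i = -1" for s
      by (rule signs[OF that v'])
    fix r r' :: "nat \<Rightarrow> real" and c :: real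
    assume c: "0 \<le> c" "c \<le> 1" and r: "\<forall>t\<ge>0. reach t (\<lambda>i j. - t * (a * b) * (r i * v' j))"
      "\<forall>t\<ge>0. reach t (\<lambda>i j. - t * (a * b) * (r' i * v' j))"
    show "\<forall>t\<ge>0. reach t (\<lambda>i j. - t * (a * b) * ((c * r i + (1 - c) * r' i) * v' j))"
    proof (intro allI impI)
      fix t :: real assume "0 \<le> t"
      then have "reach t (\<lambda>i j. c * (- t * (a * b) * (r i * v' j)) + (1 - c) * (- t * (a * b) * (r' i * v' j)))"
        using convex[OF c, of t "\<lambda>i j t. - t * (a * b) * (r i * v' j)" "\<lambda>i j t. - t * (a * b) * (r' i * v' j)"] r by simp
      then show "reach t (\<lambda>i j. - t * (a * b) * ((c * r i + (1 - c) * r' i) * v' j))"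
        by (rule reach_cong) (simp add: algebra_simps)
    qed
  qed (use u in \<open>auto simp: u'_def\<close>)
  then have "reach t (\<lambda>i j. - t * (a * b) * (u' i * v' j))" using t by blast
  then show ?thesis by (rule reach_cong) (simp add: u'_def v'_def)
qed

end

section \<open>From phases on code states to a simulation protocol\<close>

lemma embed_out_kronv:
  assumes "alpha \<in> carrier_vec a" "beta \<in> carrier_vec b"
  shows "embed_out dA dB a b chi (kronv alpha beta) = embed_in dA dB a b chi alpha beta"
proof (rule eq_vecI)
  fix i assume "i < dim_vec (embed_in dA dB a b chi alpha beta)"
  then have i: "i < dA * a * (dB * b)" by (simp add: embed_in_def)
  have A: "i div (dB * b) mod a < a" and B: "i mod (dB * b) mod b < b"
    using mod_less_of_mult[OF div_less_of_mult[OF i]] mod_less_of_mult[OF mod_less_of_mult[OF i]] by auto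
  show "embed_out dA dB a b chi (kronv alpha beta) $ i = embed_in dA dB a b chi alpha beta $ i"
    using i kronv_index[OF assms index_less_mult[OF A B]] B
    by (simp add: embed_out_def embed_in_def Let_def)
qed (simp add: embed_out_def embed_in_def)

lemma embed_in_index:
  assumes "i < dA" "x < a" "j < dB" "z < b"
  shows "embed_in dA dB a b psi alpha beta $ ((i * a + x) * (dB * b) + (j * b + z))
    = psi $ (i * dB + j) * alpha $ x * beta $ z"
  using assms index_less_mult[OF index_less_mult[OF assms(1,2)] index_less_mult[OF assms(3,4)]] index_less_mult[OF assms(3,4)]
  by (simp add: embed_in_def Let_def)

lemma lab_index_cases:
  assumes "(k::nat) < dA * a * (dB * b)"
  obtains i x j z where "i < dA" "x < a" "j < dB" "z < b" "k = (i * a + x) * (dB * b) + (j * b + z)"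
proof -
  note A = div_less_of_mult[OF assms] and B = mod_less_of_mult[OF assms]
  show thesis
    using that[OF div_less_of_mult[OF A] mod_less_of_mult[OF A] div_less_of_mult[OF B] mod_less_of_mult[OF B]]
    by (metis div_mult_mod_eq)
qed

lemma sum_eq_single:
  fixes G :: "nat \<Rightarrow> 'a::comm_monoid_add"
  assumes "x < n" "\<And>y. y < n \<Longrightarrow> y \<noteq> x \<Longrightarrow> G y = 0"
  shows "(\<Sum>y<n. G y) = G x"
  using assms by (subst sum.remove[of _ x]) (auto intro!: sum.neutral)

lemma local_on_target:
  assumes C: "C \<in> carrier_mat dA dA" and D: "D \<in> carrier_mat dB dB" and psi: "psi \<in> carrier_vec (dA * dB)"
  shows "kron (kron C (1\<^sub>m a)) (kron D (1\<^sub>m b)) *\<^sub>v embed_in dA dB a b psi alpha beta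
    = embed_in dA dB a b (kron C D *\<^sub>v psi) alpha beta"
proof (rule eq_vecI)
  note K = kron_carrier[OF C one_carrier_mat[of a]] and L = kron_carrier[OF D one_carrier_mat[of b]]
  fix k assume "k < dim_vec (embed_in dA dB a b (kron C D *\<^sub>v psi) alpha beta)"
  then have k: "k < dA * a * (dB * b)" by (simp add: embed_in_def)
  obtain i x j z where ix: "i < dA" "x < a" "j < dB" "z < b" and keq: "k = (i * a + x) * (dB * b) + (j * b + z)"
    using lab_index_cases[OF k] .
  have entry: "kron (kron C (1\<^sub>m a)) (kron D (1\<^sub>m b)) $$ (k, (i' * a + x') * (dB * b) + (j' * b + z'))
     = (if x' = x then if z' = z then C $$ (i, i') * D $$ (j, j') else 0 else 0)"
    if "i' < dA" "x' < a" "j' < dB" "z' < b" for i' x' j' z'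
    using ix that k index_less_mult[OF index_less_mult[OF that(1,2)] index_less_mult[OF that(3,4)]]
      index_less_mult[OF that(1,2)] index_less_mult[OF that(3,4)] index_less_mult[OF ix(1,2)] index_less_mult[OF ix(3,4)]
    by (auto simp: kron_index[OF K L] kron_index[OF C one_carrier_mat] kron_index[OF D one_carrier_mat] keq)
  have "(kron (kron C (1\<^sub>m a)) (kron D (1\<^sub>m b)) *\<^sub>v embed_in dA dB a b psi alpha beta) $ k
    = (\<Sum>x'<a. \<Sum>z'<b. \<Sum>i'<dA. \<Sum>j'<dB. (if x' = x then if z' = z then C $$ (i, i') * D $$ (j, j') else 0 else 0)
         * (psi $ (i' * dB + j') * alpha $ x' * beta $ z'))"
    unfolding mult_mat_vec_index[OF kron_carrier[OF K L] embed_in_carrier k] sum_lab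
    by (intro sum.cong refl) (simp add: entry embed_in_index)
  also have "\<dots> = (\<Sum>i'<dA. \<Sum>j'<dB. C $$ (i, i') * D $$ (j, j') * (psi $ (i' * dB + j') * alpha $ x * beta $ z))"
    by (rule trans[OF sum_eq_single[OF ix(2)]], simp, rule trans[OF sum_eq_single[OF ix(4)]]) simp_all
  also have "\<dots> = (\<Sum>i'<dA. \<Sum>j'<dB. kron C D $$ (i * dB + j, i' * dB + j') * psi $ (i' * dB + j')) * alpha $ x * beta $ z"
    unfolding sum_distrib_right
    by (intro sum.cong refl) (use ix in \<open>simp add: kron_index[OF C D] index_less_mult\<close>)
  also have "\<dots> = (kron C D *\<^sub>v psi) $ (i * dB + j) * alpha $ x * beta $ z"
    unfolding mult_mat_vec_index[OF kron_carrier[OF C D] psi index_less_mult[OF ix(1,3)]] sum_mult_split ..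
  finally show "(kron (kron C (1\<^sub>m a)) (kron D (1\<^sub>m b)) *\<^sub>v embed_in dA dB a b psi alpha beta) $ k
      = embed_in dA dB a b (kron C D *\<^sub>v psi) alpha beta $ k"
    unfolding keq by (simp add: embed_in_index[OF ix])
qed (use C D in \<open>auto simp: embed_in_def\<close>)

text \<open>With both ancillas in basis state 0 only the code indices carry amplitude, so the
  remaining entries of f are invisible and may be arbitrary.\<close>

lemma diagonal_on_code:
  assumes psi: "psi \<in> carrier_vec (dA * dB)" and a: "0 < a" and b: "0 < b"
  shows "diagonal (dA * a * (dB * b)) f *\<^sub>v embed_in dA dB a b psi (unit_vec a 0) (unit_vec b 0)
    = embed_in dA dB a b (diagonal (dA * dB) (\<lambda>k. f (((k div dB) * a) * (dB * b) + (k mod dB) * b)) *\<^sub>v psi) (unit_vec a 0) (unit_vec b 0)"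
proof (rule eq_vecI)
  let ?g = "\<lambda>k. f (((k div dB) * a) * (dB * b) + (k mod dB) * b)"
  fix k assume "k < dim_vec (embed_in dA dB a b (diagonal (dA * dB) ?g *\<^sub>v psi) (unit_vec a 0) (unit_vec b 0))"
  then have k: "k < dA * a * (dB * b)" by (simp add: embed_in_def)
  obtain i x j z where ix: "i < dA" "x < a" "j < dB" "z < b" and keq: "k = (i * a + x) * (dB * b) + (j * b + z)"
    using lab_index_cases[OF k] .
  show "(diagonal (dA * a * (dB * b)) f *\<^sub>v embed_in dA dB a b psi (unit_vec a 0) (unit_vec b 0)) $ k
     = embed_in dA dB a b (diagonal (dA * dB) ?g *\<^sub>v psi) (unit_vec a 0) (unit_vec b 0) $ k"
    unfolding diagonal_mult_vec[OF embed_in_carrier] diagonal_mult_vec[OF psi] index_vec[OF k]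
    unfolding keq embed_in_index[OF ix] index_vec[OF index_less_mult[OF ix(1,3)]]
    using ix by auto
qed (auto simp: embed_in_def)

lemma vnorm_unit_vec: "i < n \<Longrightarrow> vnorm (unit_vec n i) = 1"
  by (simp add: vnorm_def unit_vec_def if_distrib[of cmod] if_distrib[of "\<lambda>x. x\<^sup>2"] cong: if_cong)

lemma vnorm_zero: "vnorm (0\<^sub>v n) = 0"
  by (simp add: vnorm_def)

text \<open>The simulation is exact for each t: the ancillas return to their initial state and the
  target undergoes precisely its evolution. The time is t K' / K with the constants written through
  half-spreads.\<close>

lemma product_implementable:
  assumes pos: "0 < dA" "0 < dB" and U: "unitary dA U" and V: "unitary dB V"
    and HA: "HA = U * diagonal dA (\<lambda>i. complex_of_real (x i)) * adj U" and HB: "HB = V * diagonal dB (\<lambda>i. complex_of_real (y i)) * adj V"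
    and x: "p < dA" "q < dA" "x p = cA + a" "x q = cA - a"
    and y: "p' < dB" "q' < dB" "y p' = cB + b" "y q' = cB - b"
    and ab: "0 < a * b"
    and U': "unitary dA' U'" and V': "unitary dB' V'"
    and H': "H' = kron (U' * diagonal dA' (\<lambda>i. complex_of_real (x' i)) * adj U') (V' * diagonal dB' (\<lambda>i. complex_of_real (y' i)) * adj V')"
    and x': "\<And>i. i < dA' \<Longrightarrow> \<bar>x' i - cA'\<bar> \<le> a'" and y': "\<And>j. j < dB' \<Longrightarrow> \<bar>y' j - cB'\<bar> \<le> b'"
    and ab': "0 < a'" "0 < b'" and t: "0 \<le> t" and eps: "0 \<le> eps"
  shows "implementable dA dB (kron HA HB) (t * (a' * b') / (a * b)) dA' dB' (mexp ((- \<i> * complex_of_real t) \<cdot>\<^sub>m H')) eps"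
proof -
  define HL where "HL = lift_ham dA dB (kron HA HB) dA' dB'"
  have car: "HA \<in> carrier_mat dA dA" "HB \<in> carrier_mat dB dB"
    using unitaryD[OF U] unitaryD[OF V] by (auto simp: HA HB)
  interpret product_lab dA dB dA' dB' U V x y HL
  proof
    show "HL = kron (kron (U * diagonal dA (\<lambda>i. complex_of_real (x i)) * adj U) (1\<^sub>m dA'))
      (kron (V * diagonal dB (\<lambda>i. complex_of_real (y i)) * adj V) (1\<^sub>m dB'))"
      unfolding HL_def lift_ham_kron[OF car] unfolding HA HB ..
  qed (use pos U V in auto)
  define T where "T = t * (a' * b') / (a * b)"
  have T: "0 \<le> T" using t ab ab' by (simp add: T_def)
  have nz: "a \<noteq> 0" "b \<noteq> 0" using ab by auto
  \<comment> \<open>Dividing the centred spectra by the half-spreads brings them into [-1, 1], the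
    range covered by convex combinations of signs.\<close>
  define u v where "u i = (x' i - cA') / a'" and "v j = (y' j - cB') / b'" for i j
  have "reach T (\<lambda>i j. - T * (a * b) * (u i * v j))"
    by (rule reach_product[OF x y _ _ T]) (use x' y' ab' in \<open>auto simp: u_def v_def\<close>)
  \<comment> \<open>The added local phases undo the centring of the target, by the same splitting of
    x' y' that was used for the upper bound.\<close>
  then have "reach (T + 0) (\<lambda>i j. - T * (a * b) * (u i * v j) + ((- t * cB' * x' i) + (- t * cA' * (y' j - cB'))))"
    by (rule reach_add[OF _ reach_local])
  then have "reach T (\<lambda>i j. - t * (x' i * y' j))"
    unfolding add_0_right
  proof (rule reach_cong)
    fix i j
    have "T * (a * b) * (u i * v j) = t * ((x' i - cA') * (y' j - cB'))"
      using ab' nz by (simp add: T_def u_def v_def)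
    then show "- T * (a * b) * (u i * v j) + ((- t * cB' * x' i) + (- t * cA' * (y' j - cB'))) = - t * (x' i * y' j)"
      by (simp add: algebra_simps)
  qed
  then obtain f where f: "realizable nA nB HL T (diagonal (nA * nB) f)"
    and fc: "\<And>i j. i < dA' \<Longrightarrow> j < dB' \<Longrightarrow> f ((i * dA) * nB + j * dB) = cis (- t * (x' i * y' j))"
    unfolding reach_def by blast
  define GA where "GA = kron U' (1\<^sub>m dA)"
  define GB where "GB = kron V' (1\<^sub>m dB)"
  have G: "unitary nA GA" "unitary nB GB"
    unfolding GA_def GB_def using unitary_kron[OF U' unitary_one] unitary_kron[OF V' unitary_one] by auto
  \<comment> \<open>The phases live in the computational basis; conjugation by \<open>GA\<close> and
    \<open>GB\<close>, which act on the target factors alone, moves them to the eigenbasis of the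
    target Hamiltonian.\<close>
  have "realizable nA nB HL (0 + T + 0) (kron GA GB * (diagonal (nA * nB) f * kron (adj GA) (adj GB)))"
    by (intro realizable_mult[OF HL_carrier] realizable_local f G unitary_adj)
  then obtain steps UA UB where st: "\<forall>(UA, UB, t) \<in> set steps. unitary nA UA \<and> unitary nB UB \<and> 0 \<le> t"
    and sT: "(\<Sum>(UA, UB, t) \<leftarrow> steps. t) = T" and UAB: "unitary nA UA" "unitary nB UB"
    and M: "kron GA GB * (diagonal (nA * nB) f * kron (adj GA) (adj GB)) = kron UA UB * run_steps (nA * nB) HL steps"
    unfolding realizable_def by auto
  define alpha beta where "alpha = (unit_vec dA 0 :: complex vec)" and "beta = (unit_vec dB 0 :: complex vec)"
  have ab1: "alpha \<in> carrier_vec dA" "vnorm alpha = 1" "beta \<in> carrier_vec dB" "vnorm beta = 1"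
    using pos by (auto simp: alpha_def beta_def vnorm_unit_vec)
  define R where "R = kron U' V'"
  have R: "unitary (dA' * dB') R" unfolding R_def by (rule unitary_kron[OF U' V'])
  note RD = unitaryD[OF R] and UD = unitaryD[OF U'] and VD = unitaryD[OF V']
  define h where "h k = exp ((- \<i> * complex_of_real t) * (complex_of_real (x' (k div dB')) * complex_of_real (y' (k mod dB'))))" for k
  have E: "mexp ((- \<i> * complex_of_real t) \<cdot>\<^sub>m H') = R * diagonal (dA' * dB') h * adj R"
    unfolding H' kron_conj_diagonal[OF U' V'] R_def[symmetric] mexp_conj[OF R] h_def ..
  have exact: "kron UA UB * run_steps (nA * nB) HL steps *\<^sub>v embed_in dA' dB' dA dB psi alpha beta
      = embed_out dA' dB' dA dB (mexp ((- \<i> * complex_of_real t) \<cdot>\<^sub>m H') *\<^sub>v psi) (kronv alpha beta)"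
    if psi: "psi \<in> carrier_vec (dA' * dB')" for psi
  proof -
    let ?N = "nA * nB"
    let ?emb = "\<lambda>psi. embed_in dA' dB' dA dB psi alpha beta"
    have adjG: "adj GA = kron (adj U') (1\<^sub>m dA)" "adj GB = kron (adj V') (1\<^sub>m dB)"
      by (simp_all add: GA_def GB_def adj_kron)
    have Rpsi: "adj R *\<^sub>v psi \<in> carrier_vec (dA' * dB')" using RD psi by simp
    have GG: "kron (adj GA) (adj GB) \<in> carrier_mat ?N ?N" "kron GA GB \<in> carrier_mat ?N ?N"
      using unitaryD[OF G(1)] unitaryD[OF G(2)] by auto
    have "kron UA UB * run_steps ?N HL steps *\<^sub>v ?emb psi
       = kron GA GB *\<^sub>v (diagonal ?N f *\<^sub>v (kron (adj GA) (adj GB) *\<^sub>v ?emb psi))"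
      unfolding M[symmetric] using GG embed_in_carrier[of dA' dB' dA dB psi alpha beta]
      by (simp add: assoc_mult_mat_vec[of _ ?N ?N _ ?N])
    also have "kron (adj GA) (adj GB) *\<^sub>v ?emb psi = ?emb (adj R *\<^sub>v psi)"
      unfolding adjG R_def adj_kron by (rule local_on_target[OF UD(2) VD(2) psi])
    also have "diagonal ?N f *\<^sub>v ?emb (adj R *\<^sub>v psi)
       = ?emb (diagonal (dA' * dB') (\<lambda>k. f (((k div dB') * dA) * nB + (k mod dB') * dB)) *\<^sub>v (adj R *\<^sub>v psi))"
      unfolding alpha_def beta_def by (rule diagonal_on_code[OF Rpsi pos])
    also have "diagonal (dA' * dB') (\<lambda>k. f (((k div dB') * dA) * nB + (k mod dB') * dB)) = diagonal (dA' * dB') h"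
    proof (rule diagonal_cong)
      fix k assume k: "k < dA' * dB'"
      show "f (((k div dB') * dA) * nB + (k mod dB') * dB) = h k"
        using fc[OF div_less_of_mult[OF k] mod_less_of_mult[OF k]] by (simp add: h_def cis_conv_exp mult_ac)
    qed
    also have "kron GA GB *\<^sub>v ?emb (diagonal (dA' * dB') h *\<^sub>v (adj R *\<^sub>v psi)) = ?emb (R *\<^sub>v (diagonal (dA' * dB') h *\<^sub>v (adj R *\<^sub>v psi)))"
      unfolding GA_def GB_def R_def
      by (rule local_on_target[OF UD(1) VD(1)]) (use Rpsi in \<open>simp add: R_def\<close>)
    also have "R *\<^sub>v (diagonal (dA' * dB') h *\<^sub>v (adj R *\<^sub>v psi)) = mexp ((- \<i> * complex_of_real t) \<cdot>\<^sub>m H') *\<^sub>v psi"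
      unfolding E using RD psi by (simp add: assoc_mult_mat_vec[of _ "dA' * dB'" "dA' * dB'" _ "dA' * dB'"])
    finally show ?thesis unfolding embed_out_kronv[OF ab1(1,3)] .
  qed
  have err: "\<forall>psi \<in> carrier_vec (dA' * dB').
          vnorm (kron UA UB * run_steps (nA * nB) HL steps *\<^sub>v embed_in dA' dB' dA dB psi alpha beta
                 - embed_out dA' dB' dA dB (mexp ((- \<i> * complex_of_real t) \<cdot>\<^sub>m H') *\<^sub>v psi) (kronv alpha beta)) \<le> eps * vnorm psi"
  proof
    fix psi :: "complex vec" assume psi: "psi \<in> carrier_vec (dA' * dB')"
    show "vnorm (kron UA UB * run_steps (nA * nB) HL steps *\<^sub>v embed_in dA' dB' dA dB psi alpha beta
                 - embed_out dA' dB' dA dB (mexp ((- \<i> * complex_of_real t) \<cdot>\<^sub>m H') *\<^sub>v psi) (kronv alpha beta)) \<le> eps * vnorm psi"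
      unfolding exact[OF psi] minus_cancel_vec[OF embed_out_carrier] vnorm_zero using eps by simp
  qed
  have phi: "kronv alpha beta \<in> carrier_vec (dA * dB)" "vnorm (kronv alpha beta) = 1"
    using ab1 vnorm_kronv[OF ab1(1,3)] by auto
  have dims: "nA = dA * dA'" "nB = dB * dB'" by simp_all
  \<comment> \<open>The ancilla dimensions cross over: dA', dB' for the resource and dA, dB for the
    target. The ancillas end as they began, so the discarded state is
    \<open>kronv alpha beta\<close>.\<close>
  show ?thesis
    unfolding implementable_def T_def[symmetric]
    by (rule exI[of _ nA], rule exI[of _ nB], rule exI[of _ dA'], rule exI[of _ dB'], rule exI[of _ dA], rule exI[of _ dB],
        rule exI[of _ alpha], rule exI[of _ beta], rule exI[of _ "kronv alpha beta"], rule exI[of _ steps],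
        rule exI[of _ UA], rule exI[of _ UB], intro conjI)
      (fact dims ab1 phi st UAB err[unfolded HL_def] | rule refl | simp only: sT order_refl)+
qed

section \<open>The simulation rate\<close>

lemma conj_const:
  assumes "unitary n U" "\<And>i. i < n \<Longrightarrow> x i = c"
  shows "U * diagonal n (\<lambda>i. complex_of_real (x i)) * adj U = diagonal n (\<lambda>_. complex_of_real c)"
proof (rule eq_matI)
  fix i j assume "i < dim_row (diagonal n (\<lambda>_. complex_of_real c))" "j < dim_col (diagonal n (\<lambda>_. complex_of_real c))"
  then have ij: "i < n" "j < n" by auto
  have 1: "(U * diagonal n f * adj U) $$ (i, j) = (if i = j then a else 0)" if "\<And>l. l < n \<Longrightarrow> f l = a" for f a
  proof -
    have "(U * diagonal n f * adj U) $$ (i, j) = a * (\<Sum>l<n. U $$ (i, l) * 1 * cnj (U $$ (j, l)))"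
      unfolding conj_diagonal_index[OF assms(1) ij] sum_distrib_left by (intro sum.cong refl) (simp add: that)
    also have "(\<Sum>l<n. U $$ (i, l) * 1 * cnj (U $$ (j, l))) = (U * diagonal n (\<lambda>_. 1) * adj U) $$ (i, j)"
      by (rule conj_diagonal_index[OF assms(1) ij, symmetric])
    finally show ?thesis using unitaryD[OF assms(1)] ij by (simp add: diagonal_one)
  qed
  show "(U * diagonal n (\<lambda>i. complex_of_real (x i)) * adj U) $$ (i, j) = diagonal n (\<lambda>_. complex_of_real c) $$ (i, j)"
    using 1[of "\<lambda>i. complex_of_real (x i)" "complex_of_real c"] assms(2) ij by (simp add: diagonal_index)
qed (use unitaryD[OF assms(1)] in auto)

lemma hermitian_scale:
  assumes "hermitian n A"
  shows "hermitian n (complex_of_real c \<cdot>\<^sub>m A)"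
proof -
  have A: "A \<in> carrier_mat n n" "adj A = A" using assms by (auto simp: hermitian_def)
  have "adj (complex_of_real c \<cdot>\<^sub>m A) = complex_of_real c \<cdot>\<^sub>m adj A"
    using A(1) by (intro eq_matI) (auto simp: adj_def)
  then show ?thesis using A by (simp add: hermitian_def)
qed

lemma hermitian_zero: "hermitian n (0\<^sub>m n n)"
  by (auto simp: hermitian_def adj_def)

lemma local_if_const_left:
  assumes "hermitian dB HB"
  shows "local_ham dA dB (kron (diagonal dA (\<lambda>_. complex_of_real c)) HB)"
proof -
  have B: "HB \<in> carrier_mat dB dB" using assms by (simp add: hermitian_def)
  have "kron (diagonal dA (\<lambda>_. complex_of_real c)) HB
     = kron (0\<^sub>m dA dA) (1\<^sub>m dB) + kron (1\<^sub>m dA) (complex_of_real c \<cdot>\<^sub>m HB)"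
    using B by (intro eq_matI) (auto simp: kron_def diagonal_index div_less_of_mult mod_less_of_mult)
  then show ?thesis unfolding local_ham_def using hermitian_scale[OF assms] hermitian_zero by blast
qed

lemma local_if_const_right:
  assumes "hermitian dA HA"
  shows "local_ham dA dB (kron HA (diagonal dB (\<lambda>_. complex_of_real c)))"
proof -
  have A: "HA \<in> carrier_mat dA dA" using assms by (simp add: hermitian_def)
  have "kron HA (diagonal dB (\<lambda>_. complex_of_real c))
     = kron (complex_of_real c \<cdot>\<^sub>m HA) (1\<^sub>m dB) + kron (1\<^sub>m dA) (0\<^sub>m dB dB)"
    using A by (intro eq_matI) (auto simp: kron_def diagonal_index div_less_of_mult mod_less_of_mult)
  then show ?thesis unfolding local_ham_def using hermitian_scale[OF assms] hermitian_zero by blast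
qed

text \<open>Centring at the midpoint of the extremes makes the largest deviation half the spread;
  the two halves produce the factor 1/4 in \<open>K_prod\<close>.\<close>

lemma hermitian_centred_spectrum:
  assumes "hermitian n A" "0 < n"
  obtains U x p q c where "unitary n U" "A = U * diagonal n (\<lambda>i. complex_of_real (x i)) * adj U"
    "p < n" "q < n" "x p = c + spread A / 2" "x q = c - spread A / 2"
    "\<And>i. i < n \<Longrightarrow> \<bar>x i - c\<bar> \<le> spread A / 2" "0 \<le> spread A"
    "spread A = 0 \<Longrightarrow> A = diagonal n (\<lambda>_. complex_of_real c)"
proof -
  obtain U x p q where *: "unitary n U" "A = U * diagonal n (\<lambda>i. complex_of_real (x i)) * adj U"
    "p < n" "q < n" "\<And>i. i < n \<Longrightarrow> x q \<le> x i \<and> x i \<le> x p" "spread A = x p - x q"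
    using hermitian_spectral_spread[OF assms] by blast
  define c where "c = (x p + x q) / 2"
  have bd: "\<bar>x i - c\<bar> \<le> spread A / 2" if "i < n" for i
    using *(5)[OF that] unfolding *(6) c_def by (auto simp: abs_le_iff field_simps)
  show thesis
  proof (rule that[OF *(1-4) _ _ bd])
    show "x p = c + spread A / 2" "x q = c - spread A / 2" "0 \<le> spread A"
      using *(5)[OF *(3)] unfolding *(6) c_def by (simp_all add: field_simps)
    show "A = diagonal n (\<lambda>_. complex_of_real c)" if "spread A = 0"
    proof -
      have "x i = c" if "i < n" for i using bd[OF that] \<open>spread A = 0\<close> by simp
      then show ?thesis using conj_const[OF *(1), of x c] *(2) by simp
    qed
  qed
qed

text \<open>A Hermitian factor of zero spread is a real multiple of the identity, and a scalar can
  be moved into the other factor, leaving a local Hamiltonian.\<close>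

lemma nonlocal_product_spread_pos:
  assumes "0 < dA" "0 < dB" "hermitian dA HA" "hermitian dB HB" "nonlocal_ham dA dB (kron HA HB)"
  shows "0 < spread HA" "0 < spread HB"
proof -
  have nl: "\<not> local_ham dA dB (kron HA HB)" using assms(5) by (simp add: nonlocal_ham_def)
  obtain c where "0 \<le> spread HA" "spread HA = 0 \<Longrightarrow> HA = diagonal dA (\<lambda>_. complex_of_real c)"
    using hermitian_centred_spectrum[OF assms(3,1)] by metis
  then show "0 < spread HA" using nl local_if_const_left[OF assms(4)] by fastforce
  obtain c where "0 \<le> spread HB" "spread HB = 0 \<Longrightarrow> HB = diagonal dB (\<lambda>_. complex_of_real c)"
    using hermitian_centred_spectrum[OF assms(4,2)] by metis
  then show "0 < spread HB" using nl local_if_const_right[OF assms(3)] by fastforce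
qed

text \<open>With z = t K' / 2 and r = K / (\<gamma> K'), letting \<open>eps\<close> vanish turns the
  bound into sin z \<le> r z. For r < 1 this fails at small z, since sin z / z tends to 1.\<close>

lemma rate_le_of_small_time_bound:
  fixes K K' \<gamma> :: real
  assumes K: "0 < K" "0 < K'" "0 < \<gamma>"
    and bound: "\<And>t eps. 0 \<le> t \<Longrightarrow> t * K' \<le> pi / 4 \<Longrightarrow> 0 < eps \<Longrightarrow> 2 - 2 * cos (t * K') \<le> (K * (t / \<gamma>) + eps)\<^sup>2"
  shows "\<gamma> \<le> K / K'"
proof (rule ccontr)
  assume "\<not> \<gamma> \<le> K / K'"
  define r where "r = K / (\<gamma> * K')"
  have r: "0 < r" "r < 1" using K \<open>\<not> \<gamma> \<le> K / K'\<close> by (auto simp: r_def field_simps)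
  \<comment> \<open>By the mean value theorem sin z = z cos \<xi> with 0 < \<xi> < z; z \<le> arccos
    r makes cos \<xi> > r, and z \<le> pi / 8 keeps t K' = 2 z within pi / 4.\<close>
  define z where "z = min (arccos r) (pi / 8)"
  have z: "0 < z" "z \<le> pi / 8" "z \<le> arccos r" "z < pi"
    using r arccos_lt_bounded[of r] pi_gt_zero by (auto simp: z_def min_def)
  obtain \<xi> where xi: "0 < \<xi>" "\<xi> < z" and sin: "sin z = z * cos \<xi>"
    using MVT2[of 0 z sin cos] z(1) by (auto intro: DERIV_sin)
  have "r = cos (arccos r)" using r by simp
  also have "\<dots> < cos \<xi>"
    using xi z r arccos_ubound[of r] by (intro cos_monotone_0_pi) auto
  finally have gt: "z * r < sin z" unfolding sin using z(1) by simp
  define t where "t = 2 * z / K'"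
  have t: "0 \<le> t" "t * K' = 2 * z" "t * K' \<le> pi / 4" "K * (t / \<gamma>) = 2 * (z * r)"
    using K z by (auto simp: t_def r_def field_simps)
  have "2 * sin z \<le> K * (t / \<gamma>) + e" if e: "0 < e" for e
  proof -
    have "(2 * sin z)\<^sup>2 = 2 - 2 * cos (t * K')"
      unfolding t(2) cos_double_sin by (simp add: power_mult_distrib)
    also have "\<dots> \<le> (K * (t / \<gamma>) + e)\<^sup>2" by (rule bound[OF t(1,3) e])
    finally show ?thesis by (rule power2_le_imp_le) (use K t(1) e in auto)
  qed
  then have "2 * sin z \<le> K * (t / \<gamma>)" by (rule field_le_epsilon)
  with gt t(4) show False by simp
qed

text \<open>The hypotheses on resource and target are the same, so the rate of the reverse
  simulation is another instance.\<close>

lemma sim_rate_product: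
  assumes d: "0 < dA" "0 < dB" "0 < dA'" "0 < dB'"
    and h: "hermitian dA HA" "hermitian dB HB" "hermitian dA' HA'" "hermitian dB' HB'"
    and sp: "0 < spread HA" "0 < spread HB" "0 < spread HA'" "0 < spread HB'"
  shows "sim_rate dA' dB' (kron HA' HB') dA dB (kron HA HB) = K_prod HA HB / K_prod HA' HB'"
proof -
  obtain U x p q cA where A: "unitary dA U" "HA = U * diagonal dA (\<lambda>i. complex_of_real (x i)) * adj U"
    "p < dA" "q < dA" "x p = cA + spread HA / 2" "x q = cA - spread HA / 2"
    "\<And>i. i < dA \<Longrightarrow> \<bar>x i - cA\<bar> \<le> spread HA / 2"
    using hermitian_centred_spectrum[OF h(1) d(1)] by metis
  obtain V y p1 q1 cB where B: "unitary dB V" "HB = V * diagonal dB (\<lambda>i. complex_of_real (y i)) * adj V"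
    "p1 < dB" "q1 < dB" "y p1 = cB + spread HB / 2" "y q1 = cB - spread HB / 2"
    "\<And>i. i < dB \<Longrightarrow> \<bar>y i - cB\<bar> \<le> spread HB / 2"
    using hermitian_centred_spectrum[OF h(2) d(2)] by metis
  obtain U' x' k l cA' where A': "unitary dA' U'" "HA' = U' * diagonal dA' (\<lambda>i. complex_of_real (x' i)) * adj U'"
    "k < dA'" "l < dA'" "x' k = cA' + spread HA' / 2" "x' l = cA' - spread HA' / 2"
    "\<And>i. i < dA' \<Longrightarrow> \<bar>x' i - cA'\<bar> \<le> spread HA' / 2"
    using hermitian_centred_spectrum[OF h(3) d(3)] by metis
  obtain V' y' m n cB' where B': "unitary dB' V'" "HB' = V' * diagonal dB' (\<lambda>i. complex_of_real (y' i)) * adj V'"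
    "m < dB'" "n < dB'" "y' m = cB' + spread HB' / 2" "y' n = cB' - spread HB' / 2"
    "\<And>i. i < dB' \<Longrightarrow> \<bar>y' i - cB'\<bar> \<le> spread HB' / 2"
    using hermitian_centred_spectrum[OF h(4) d(4)] by metis
  have ne: "k \<noteq> l" "m \<noteq> n" using A'(5,6) B'(5,6) sp by auto
  define K K' where "K = K_prod HA HB" and "K' = K_prod HA' HB'"
  have Keq: "K = spread HA / 2 * (spread HB / 2)" "K' = spread HA' / 2 * (spread HB' / 2)"
    by (simp_all add: K_def K'_def K_prod_def)
  have Kpos: "0 < K" "0 < K'" using sp by (simp_all add: Keq)
  have H': "kron HA' HB' = kron (U' * diagonal dA' (\<lambda>i. complex_of_real (x' i)) * adj U') (V' * diagonal dB' (\<lambda>i. complex_of_real (y' i)) * adj V')"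
    by (simp only: A'(2)[symmetric] B'(2)[symmetric])
  have half: "0 \<le> spread HA / 2" "0 \<le> spread HB / 2" "0 < spread HA' / 2" "0 < spread HB' / 2"
    "0 < spread HA / 2 * (spread HB / 2)" using sp by auto
  have lower: "simulates_at_rate dA' dB' (kron HA' HB') dA dB (kron HA HB) (K / K')"
    unfolding simulates_at_rate_def
  proof (intro allI impI)
    fix t \<epsilon> :: real assume t: "0 \<le> t" and e: "0 < \<epsilon>"
    have "t / (K / K') = t * (spread HA' / 2 * (spread HB' / 2)) / (spread HA / 2 * (spread HB / 2))"
      by (simp add: Keq)
    then show "implementable dA dB (kron HA HB) (t / (K / K')) dA' dB'
        (mexp ((- \<i> * complex_of_real t) \<cdot>\<^sub>m kron HA' HB')) \<epsilon>"
      using product_implementable[OF d(1,2) A(1) B(1) A(2) B(2) A(3-6) B(3-6) half(5) A'(1) B'(1) H' A'(7) B'(7) half(3,4) t, of \<epsilon>] e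
      by simp
  qed
  have upper: "\<gamma> \<le> K / K'" if \<gamma>: "0 < \<gamma>" and sim: "simulates_at_rate dA' dB' (kron HA' HB') dA dB (kron HA HB) \<gamma>" for \<gamma>
  proof (rule rate_le_of_small_time_bound[OF Kpos \<gamma>])
    fix t eps :: real assume t: "0 \<le> t" "t * K' \<le> pi / 4" and e: "0 < eps"
    have impl: "implementable dA dB (kron HA HB) (t / \<gamma>) dA' dB' (mexp ((- \<i> * complex_of_real t) \<cdot>\<^sub>m kron HA' HB')) eps"
      using sim t(1) e unfolding simulates_at_rate_def by blast
    have t': "0 \<le> t * (spread HA' / 2 * (spread HB' / 2))" "t * (spread HA' / 2 * (spread HB' / 2)) \<le> pi / 4"
      using t Kpos unfolding Keq(2)[symmetric] by auto
    show "2 - 2 * cos (t * K') \<le> (K * (t / \<gamma>) + eps)\<^sup>2"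
      unfolding Keq
      by (rule implementable_imp_time_bound[OF A(1) B(1) A(2) B(2) A(7) B(7) half(1,2) less_imp_le[OF e] A'(1) B'(1) H'
          A'(3,4) ne(1) A'(5,6) B'(3,4) ne(2) B'(5,6) t' impl])
  qed
  \<comment> \<open>The supremum is a maximum: the rate K / K' is itself attained.\<close>
  have "Sup ({0} \<union> {\<gamma>. \<gamma> > 0 \<and> simulates_at_rate dA' dB' (kron HA' HB') dA dB (kron HA HB) \<gamma>}) = K / K'"
  proof (rule cSup_eq_maximum)
    show "K / K' \<in> {0} \<union> {\<gamma>. \<gamma> > 0 \<and> simulates_at_rate dA' dB' (kron HA' HB') dA dB (kron HA HB) \<gamma>}"
      using lower Kpos by simp
  qed (use upper Kpos in auto)
  then show ?thesis by (simp add: sim_rate_def K_def K'_def)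
qed

theorem theorem1:
  fixes dA dB dA' dB' :: nat and HA HB HA' HB' :: "complex mat"
  assumes "0 < dA" "0 < dB" "0 < dA'" "0 < dB'"
    and "hermitian dA HA" "hermitian dB HB"
    and "hermitian dA' HA'" "hermitian dB' HB'"
    and "nonlocal_ham dA dB (kron HA HB)"
    and "nonlocal_ham dA' dB' (kron HA' HB')"
  shows "sim_rate dA' dB' (kron HA' HB') dA dB (kron HA HB) = K_prod HA HB / K_prod HA' HB'
    \<and> sim_rate dA' dB' (kron HA' HB') dA dB (kron HA HB)
      * sim_rate dA dB (kron HA HB) dA' dB' (kron HA' HB') = 1"
proof -
  note sp = nonlocal_product_spread_pos[OF assms(1,2,5,6,9)] nonlocal_product_spread_pos[OF assms(3,4,7,8,10)]
  have "K_prod HA HB \<noteq> 0" "K_prod HA' HB' \<noteq> 0" using sp by (simp_all add: K_prod_def)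
  then show ?thesis
    using sim_rate_product[OF assms(1-8) sp] sim_rate_product[OF assms(3,4,1,2,7,8,5,6) sp(3,4,1,2)] by simp
qed

end
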